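(* Let $M$ be a smooth manifold. The forces (vertical vector fields on $TM$) which are relativistic and depend linearly on the velocities are canonically associated with differential 2-forms on $M$, once the (non-degenerate) pseudo-Riemannian metric $T_2$ is given on $M$.
   Context: All objects are smooth; $\pi\colon TM\to M$ is the tangent bundle and $T_2$ is a non-degenerate pseudo-Riemannian metric on $M$. For a vertical vector field $W$ on $TM$ (i.e. $\pi_*W=0$), its geometric representative is the map $w\colon TM\to TM$ with $w(v_a)\in T_aM$ for $v_a\in T_aM$, obtained through the canonical identification $T_{v_a}(T_aM)\cong T_aM$. In coordinates $(q^i,\dot q^i)$ on $TM$ induced by coordinates $q^i$ on $M$, if $W=w^i(q,\dot q)\,\partial/\partial\dot q^i$ then $w=w^i(q,\dot q)\,\partial/\partial q^i$. A second order differential equation on $M$ is a vector field $D$ on $TM$ such that $\pi_*(D_{v_a})=v_a$ for every $v_a\in TM$. The kinetic energy of $T_2$ is the function $T\colon TM\to\mathbb{R}$, $T(v_a)=\tfrac12 T_2(v_a,v_a)$. The Liouville form $\theta$ on $TM$ is the 1-form with $\theta_{v_a}=\pi^*(i_{v_a}T_2)$, and $\omega_2=d\theta$ is a symplectic form on $TM$. The geodesic field $D_G$ is the second order differential equation determined by $i_{D_G}\omega_2+dT=0$. Every second order differential equation is uniquely of the form $D=D_G+W$ with $W$ a vertical vector field (called the force). A second order differential equation $D$ is called a relativistic field on $(M,T_2)$ if $DT=0$. A vertical field (force) $W$ is called relativistic if $D_G+W$ is a relativistic field. A vertical field $W$ depends linearly on the velocities if there is a field of endomorphisms $\Phi$ on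 $M$ (that is, $\Phi_a\in\operatorname{Hom}(T_aM,T_aM)$ for each $a\in M$) such that the geometric representative of $W$ is $w(v_a)=\Phi_a(v_a)$ for all $v_a\in T_aM$. Meaning of "associated": a force $W$ with geometric representative $w$ and a 2-form $\Phi_2$ on $M$ are related through the metric by $i_{w(v_a)}T_2+i_{v_a}\Phi_2=0$ in $T_a^*M$ for $v_a\in T_aM$. *)

theory Defs
  imports "HOL-Analysis.Analysis"
begin

section \<open>Smooth functions between normed spaces\<close>

text \<open>
  \<open>Ck_on k f S\<close> is meant for open \<open>S\<close>. In finite dimension, \<open>C\<^sup>k\<^sup>+\<^sup>1\<close> means
  differentiable with all directional derivatives of class \<open>C\<^sup>k\<close>.
\<close>

primrec Ck_on :: "nat \<Rightarrow> ('e::real_normed_vector \<Rightarrow> 'f::real_normed_vector) \<Rightarrow> 'e set \<Rightarrow> bool" where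
  "Ck_on 0 f S \<longleftrightarrow> continuous_on S f"
| "Ck_on (Suc k) f S \<longleftrightarrow>
     (\<forall>x\<in>S. f differentiable (at x)) \<and>
     (\<forall>v. Ck_on k (\<lambda>x. frechet_derivative f (at x) v) S)"

definition smooth_on :: "'e::real_normed_vector set \<Rightarrow> ('e \<Rightarrow> 'f::real_normed_vector) \<Rightarrow> bool" where
  "smooth_on S f \<longleftrightarrow> (\<forall>k. Ck_on k f S)"


section \<open>Manifolds given by an atlas\<close>

text \<open>
  A chart is a pair of its domain and its coordinate map; the values of the map outside the domain
  are irrelevant. The smooth structure is given by an arbitrary, not necessarily maximal, atlas.
\<close>

type_synonym ('a, 'e) chart = "'a set \<times> ('a \<Rightarrow> 'e)"

definition chart_range :: "('a, 'e) chart \<Rightarrow> 'e set" where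
  "chart_range c = snd c ` fst c"

definition chart_inv :: "('a, 'e) chart \<Rightarrow> 'e \<Rightarrow> 'a" where
  "chart_inv c = inv_into (fst c) (snd c)"

definition transition :: "('a, 'e) chart \<Rightarrow> ('a, 'e) chart \<Rightarrow> 'e \<Rightarrow> 'e" where
  "transition c d = snd d \<circ> chart_inv c"

definition points :: "('a, 'e) chart set \<Rightarrow> 'a set" where
  "points A = (\<Union>c\<in>A. fst c)"

definition smooth_manifold :: "'a topology \<Rightarrow> ('a, 'e::euclidean_space) chart set \<Rightarrow> bool" where
  "smooth_manifold X A \<longleftrightarrow>
     Hausdorff_space X \<and> second_countable X \<and> points A = topspace X \<and>
     (\<forall>c\<in>A. openin X (fst c) \<and> open (chart_range c) \<and>
        homeomorphic_map (subtopology X (fst c)) (top_of_set (chart_range c)) (snd c)) \<and>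
     (\<forall>c\<in>A. \<forall>d\<in>A. smooth_on (snd c ` (fst c \<inter> fst d)) (transition c d))"

definition chart_at :: "('a, 'e) chart set \<Rightarrow> 'a \<Rightarrow> ('a, 'e) chart" where
  "chart_at A p = (SOME c. c \<in> A \<and> p \<in> fst c)"


section \<open>Tangent vectors\<close>

text \<open>
  A tangent vector at \<open>p\<close> is the family of its components in all charts around \<open>p\<close>, which transform
  by the derivatives of the transition maps. The components at the other charts are set to zero, so
  that the vector space operations of the tangent space are the componentwise ones and its zero
  is \<open>\<lambda>c. 0\<close>.
\<close>

type_synonym ('a, 'e) tvec = "('a, 'e) chart \<Rightarrow> 'e"

definition tangent_space ::
    "('a, 'e::real_normed_vector) chart set \<Rightarrow> 'a \<Rightarrow> ('a, 'e) tvec set" where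
  "tangent_space A p = {v.
     (\<forall>c. \<not> (c \<in> A \<and> p \<in> fst c) \<longrightarrow> v c = 0) \<and>
     (\<forall>c\<in>A. \<forall>d\<in>A. p \<in> fst c \<inter> fst d \<longrightarrow>
        v d = frechet_derivative (transition c d) (at (snd c p)) (v c))}"

text \<open>The tangent vector at \<open>p\<close> whose component in the chart \<open>c\<close> is \<open>e\<close>.\<close>

definition coord_vector ::
    "('a, 'e::real_normed_vector) chart set \<Rightarrow> ('a, 'e) chart \<Rightarrow> 'a \<Rightarrow> 'e \<Rightarrow> ('a, 'e) tvec" where
  "coord_vector A c p e =
     (\<lambda>d. if d \<in> A \<and> p \<in> fst d
          then frechet_derivative (transition c d) (at (snd c p)) e else 0)"

definition velocity ::
    "('a, 'e::real_normed_vector) chart set \<Rightarrow> (real \<Rightarrow> 'a) \<Rightarrow> real \<Rightarrow> ('a, 'e) tvec" where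
  "velocity A \<gamma> t =
     (\<lambda>c. if c \<in> A \<and> \<gamma> t \<in> fst c then vector_derivative (\<lambda>s. snd c (\<gamma> s)) (at t) else 0)"

text \<open>
  The tangent map of \<open>f\<close> and the differential of a real function, computed in one chart around the
  point; for smooth \<open>f\<close> the result does not depend on that chart.
\<close>

definition tangent_map ::
    "('a, 'e::real_normed_vector) chart set \<Rightarrow> ('b, 'f::real_normed_vector) chart set \<Rightarrow>
     ('a \<Rightarrow> 'b) \<Rightarrow> 'a \<Rightarrow> ('a, 'e) tvec \<Rightarrow> ('b, 'f) tvec" where
  "tangent_map A B f p v =
     (let c = chart_at A p in
      (\<lambda>d. if d \<in> B \<and> f p \<in> fst d
           then frechet_derivative (snd d \<circ> f \<circ> chart_inv c) (at (snd c p)) (v c) else 0))"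

definition differential ::
    "('a, 'e::real_normed_vector) chart set \<Rightarrow> ('a \<Rightarrow> real) \<Rightarrow> 'a \<Rightarrow> ('a, 'e) tvec \<Rightarrow> real" where
  "differential A f p v =
     (let c = chart_at A p in frechet_derivative (f \<circ> chart_inv c) (at (snd c p)) (v c))"


section \<open>Vector fields, tensor fields and differential forms\<close>

text \<open>
  Fields are smooth and are extensional functions (undefined off the manifold, respectively off the
  tangent spaces), so that equality of fields is equality of functions.
\<close>

definition vector_field ::
    "('a, 'e::real_normed_vector) chart set \<Rightarrow> ('a \<Rightarrow> ('a, 'e) tvec) \<Rightarrow> bool" where
  "vector_field A X \<longleftrightarrow>
     X \<in> (\<Pi>\<^sub>E p\<in>points A. tangent_space A p) \<and>
     (\<forall>c\<in>A. smooth_on (chart_range c) (\<lambda>x. X (chart_inv c x) c))"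

definition bilinear_tensor_field ::
    "('a, 'e::real_normed_vector) chart set \<Rightarrow>
     ('a \<Rightarrow> ('a, 'e) tvec \<Rightarrow> ('a, 'e) tvec \<Rightarrow> real) \<Rightarrow> bool" where
  "bilinear_tensor_field A B \<longleftrightarrow>
     B \<in> (\<Pi>\<^sub>E p\<in>points A. \<Pi>\<^sub>E u\<in>tangent_space A p. \<Pi>\<^sub>E v\<in>tangent_space A p. UNIV) \<and>
     (\<forall>p\<in>points A. \<forall>u\<in>tangent_space A p. \<forall>v\<in>tangent_space A p. \<forall>w\<in>tangent_space A p. \<forall>r s.
        B p (\<lambda>c. r *\<^sub>R u c + s *\<^sub>R v c) w = r * B p u w + s * B p v w \<and>
        B p w (\<lambda>c. r *\<^sub>R u c + s *\<^sub>R v c) = r * B p w u + s * B p w v) \<and>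
     (\<forall>c\<in>A. \<forall>e f. smooth_on (chart_range c)
        (\<lambda>x. B (chart_inv c x) (coord_vector A c (chart_inv c x) e)
                               (coord_vector A c (chart_inv c x) f)))"

definition two_form ::
    "('a, 'e::real_normed_vector) chart set \<Rightarrow>
     ('a \<Rightarrow> ('a, 'e) tvec \<Rightarrow> ('a, 'e) tvec \<Rightarrow> real) \<Rightarrow> bool" where
  "two_form A F \<longleftrightarrow>
     bilinear_tensor_field A F \<and> (\<forall>p\<in>points A. \<forall>u\<in>tangent_space A p. F p u u = 0)"

definition pseudo_riemannian_metric ::
    "('a, 'e::real_normed_vector) chart set \<Rightarrow>
     ('a \<Rightarrow> ('a, 'e) tvec \<Rightarrow> ('a, 'e) tvec \<Rightarrow> real) \<Rightarrow> bool" where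
  "pseudo_riemannian_metric A g \<longleftrightarrow>
     bilinear_tensor_field A g \<and>
     (\<forall>p\<in>points A. \<forall>u\<in>tangent_space A p. \<forall>v\<in>tangent_space A p. g p u v = g p v u) \<and>
     (\<forall>p\<in>points A. \<forall>u\<in>tangent_space A p.
        (\<forall>v\<in>tangent_space A p. g p u v = 0) \<longrightarrow> u = (\<lambda>c. 0))"

definition endomorphism_field ::
    "('a, 'e::real_normed_vector) chart set \<Rightarrow>
     ('a \<Rightarrow> ('a, 'e) tvec \<Rightarrow> ('a, 'e) tvec) \<Rightarrow> bool" where
  "endomorphism_field A \<Phi> \<longleftrightarrow>
     \<Phi> \<in> (\<Pi>\<^sub>E p\<in>points A. tangent_space A p \<rightarrow>\<^sub>E tangent_space A p) \<and>
     (\<forall>p\<in>points A. \<forall>u\<in>tangent_space A p. \<forall>v\<in>tangent_space A p. \<forall>r s.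
        \<Phi> p (\<lambda>c. r *\<^sub>R u c + s *\<^sub>R v c) = (\<lambda>c. r *\<^sub>R \<Phi> p u c + s *\<^sub>R \<Phi> p v c)) \<and>
     (\<forall>c\<in>A. \<forall>e. smooth_on (chart_range c)
        (\<lambda>x. \<Phi> (chart_inv c x) (coord_vector A c (chart_inv c x) e) c))"

text \<open>
  Exterior derivative of a 1-form \<open>\<alpha>\<close>, from its expression in a chart: for \<open>\<alpha> = \<alpha>\<^sub>j dx\<^sup>j\<close>,
  \<open>d\<alpha>(u,v) = u\<^sup>i v\<^sup>j (\<partial>\<^sub>i \<alpha>\<^sub>j - \<partial>\<^sub>j \<alpha>\<^sub>i)\<close>. There is no factor \<open>1/2\<close>, so that
  \<open>(dx \<and> dy)(u,v) = u\<^sup>x v\<^sup>y - u\<^sup>y v\<^sup>x\<close>.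
\<close>

definition exterior_derivative ::
    "('a, 'e::real_normed_vector) chart set \<Rightarrow> ('a \<Rightarrow> ('a, 'e) tvec \<Rightarrow> real) \<Rightarrow>
     'a \<Rightarrow> ('a, 'e) tvec \<Rightarrow> ('a, 'e) tvec \<Rightarrow> real" where
  "exterior_derivative A \<alpha> p u v =
     (let c = chart_at A p;
          \<alpha>\<^sub>c = (\<lambda>e x. \<alpha> (chart_inv c x) (coord_vector A c (chart_inv c x) e))
      in frechet_derivative (\<alpha>\<^sub>c (v c)) (at (snd c p)) (u c)
         - frechet_derivative (\<alpha>\<^sub>c (u c)) (at (snd c p)) (v c))"


section \<open>The tangent bundle\<close>

text \<open>
  A point of \<open>TM\<close> is a pair of a point of \<open>M\<close> and a tangent vector there, the projection \<open>\<pi>\<close> is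
  \<open>fst\<close>, and each chart \<open>q\<close> of \<open>M\<close> induces the chart \<open>(q, dq)\<close> of \<open>TM\<close>. With the atlas of these
  charts, all of the above applies to \<open>TM\<close>.
\<close>

type_synonym ('a, 'e) tpoint = "'a \<times> ('a, 'e) tvec"

definition tangent_bundle ::
    "('a, 'e::real_normed_vector) chart set \<Rightarrow> ('a, 'e) tpoint set" where
  "tangent_bundle A = (SIGMA p:points A. tangent_space A p)"

definition tangent_chart ::
    "('a, 'e::real_normed_vector) chart set \<Rightarrow> ('a, 'e) chart \<Rightarrow>
     (('a, 'e) tpoint, 'e \<times> 'e) chart" where
  "tangent_chart A c = ({z \<in> tangent_bundle A. fst z \<in> fst c}, \<lambda>z. (snd c (fst z), snd z c))"

definition tangent_atlas ::
    "('a, 'e::real_normed_vector) chart set \<Rightarrow> (('a, 'e) tpoint, 'e \<times> 'e) chart set" where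
  "tangent_atlas A = tangent_chart A ` A"

definition vertical_field ::
    "('a, 'e::real_normed_vector) chart set \<Rightarrow>
     (('a, 'e) tpoint \<Rightarrow> (('a, 'e) tpoint, 'e \<times> 'e) tvec) \<Rightarrow> bool" where
  "vertical_field A W \<longleftrightarrow>
     vector_field (tangent_atlas A) W \<and>
     (\<forall>z\<in>tangent_bundle A. tangent_map (tangent_atlas A) A fst z (W z) = (\<lambda>c. 0))"

text \<open>
  The canonical map \<open>T\<^sub>aM \<rightarrow> T\<^sub>v(T\<^sub>aM) \<subseteq> T\<^sub>v(TM)\<close>: the velocity at \<open>t = 0\<close> of the curve
  \<open>t \<mapsto> v + t u\<close> in the fibre. The geometric representative is its inverse applied to \<open>W\<close>.
\<close>

definition vertical_lift ::
    "('a, 'e::real_normed_vector) chart set \<Rightarrow> ('a, 'e) tpoint \<Rightarrow> ('a, 'e) tvec \<Rightarrow>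
     (('a, 'e) tpoint, 'e \<times> 'e) tvec" where
  "vertical_lift A z u =
     velocity (tangent_atlas A) (\<lambda>t. (fst z, \<lambda>c. snd z c + t *\<^sub>R u c)) 0"

definition geometric_representative ::
    "('a, 'e::real_normed_vector) chart set \<Rightarrow>
     (('a, 'e) tpoint \<Rightarrow> (('a, 'e) tpoint, 'e \<times> 'e) tvec) \<Rightarrow> ('a, 'e) tpoint \<Rightarrow> ('a, 'e) tvec" where
  "geometric_representative A W z =
     (THE u. u \<in> tangent_space A (fst z) \<and> vertical_lift A z u = W z)"

definition second_order_field ::
    "('a, 'e::real_normed_vector) chart set \<Rightarrow>
     (('a, 'e) tpoint \<Rightarrow> (('a, 'e) tpoint, 'e \<times> 'e) tvec) \<Rightarrow> bool" where
  "second_order_field A D \<longleftrightarrow>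
     vector_field (tangent_atlas A) D \<and>
     (\<forall>z\<in>tangent_bundle A. tangent_map (tangent_atlas A) A fst z (D z) = snd z)"


section \<open>Mechanics on a pseudo-Riemannian manifold\<close>

definition kinetic_energy ::
    "('a \<Rightarrow> ('a, 'e) tvec \<Rightarrow> ('a, 'e) tvec \<Rightarrow> real) \<Rightarrow> ('a, 'e) tpoint \<Rightarrow> real" where
  "kinetic_energy g z = g (fst z) (snd z) (snd z) / 2"

definition liouville_form ::
    "('a, 'e::real_normed_vector) chart set \<Rightarrow>
     ('a \<Rightarrow> ('a, 'e) tvec \<Rightarrow> ('a, 'e) tvec \<Rightarrow> real) \<Rightarrow>
     ('a, 'e) tpoint \<Rightarrow> (('a, 'e) tpoint, 'e \<times> 'e) tvec \<Rightarrow> real" where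
  "liouville_form A g z \<xi> = g (fst z) (snd z) (tangent_map (tangent_atlas A) A fst z \<xi>)"

definition symplectic_form ::
    "('a, 'e::real_normed_vector) chart set \<Rightarrow>
     ('a \<Rightarrow> ('a, 'e) tvec \<Rightarrow> ('a, 'e) tvec \<Rightarrow> real) \<Rightarrow>
     ('a, 'e) tpoint \<Rightarrow> (('a, 'e) tpoint, 'e \<times> 'e) tvec \<Rightarrow>
     (('a, 'e) tpoint, 'e \<times> 'e) tvec \<Rightarrow> real" where
  "symplectic_form A g = exterior_derivative (tangent_atlas A) (liouville_form A g)"

definition geodesic_field ::
    "('a, 'e::real_normed_vector) chart set \<Rightarrow>
     ('a \<Rightarrow> ('a, 'e) tvec \<Rightarrow> ('a, 'e) tvec \<Rightarrow> real) \<Rightarrow>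
     ('a, 'e) tpoint \<Rightarrow> (('a, 'e) tpoint, 'e \<times> 'e) tvec" where
  "geodesic_field A g = (THE D. second_order_field A D \<and>
     (\<forall>z\<in>tangent_bundle A. \<forall>\<xi>\<in>tangent_space (tangent_atlas A) z.
        symplectic_form A g z (D z) \<xi>
        + differential (tangent_atlas A) (kinetic_energy g) z \<xi> = 0))"

definition relativistic_field ::
    "('a, 'e::real_normed_vector) chart set \<Rightarrow>
     ('a \<Rightarrow> ('a, 'e) tvec \<Rightarrow> ('a, 'e) tvec \<Rightarrow> real) \<Rightarrow>
     (('a, 'e) tpoint \<Rightarrow> (('a, 'e) tpoint, 'e \<times> 'e) tvec) \<Rightarrow> bool" where
  "relativistic_field A g D \<longleftrightarrow>
     second_order_field A D \<and>
     (\<forall>z\<in>tangent_bundle A. differential (tangent_atlas A) (kinetic_energy g) z (D z) = 0)"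

definition relativistic_force ::
    "('a, 'e::real_normed_vector) chart set \<Rightarrow>
     ('a \<Rightarrow> ('a, 'e) tvec \<Rightarrow> ('a, 'e) tvec \<Rightarrow> real) \<Rightarrow>
     (('a, 'e) tpoint \<Rightarrow> (('a, 'e) tpoint, 'e \<times> 'e) tvec) \<Rightarrow> bool" where
  "relativistic_force A g W \<longleftrightarrow>
     vertical_field A W \<and>
     relativistic_field A g (\<lambda>z\<in>tangent_bundle A. \<lambda>C. geodesic_field A g z C + W z C)"

definition linear_in_velocities ::
    "('a, 'e::real_normed_vector) chart set \<Rightarrow>
     (('a, 'e) tpoint \<Rightarrow> (('a, 'e) tpoint, 'e \<times> 'e) tvec) \<Rightarrow> bool" where
  "linear_in_velocities A W \<longleftrightarrow>
     (\<exists>\<Phi>. endomorphism_field A \<Phi> \<and>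
        (\<forall>z\<in>tangent_bundle A. geometric_representative A W z = \<Phi> (fst z) (snd z)))"

definition associated ::
    "('a, 'e::real_normed_vector) chart set \<Rightarrow>
     ('a \<Rightarrow> ('a, 'e) tvec \<Rightarrow> ('a, 'e) tvec \<Rightarrow> real) \<Rightarrow>
     (('a, 'e) tpoint \<Rightarrow> (('a, 'e) tpoint, 'e \<times> 'e) tvec) \<Rightarrow>
     ('a \<Rightarrow> ('a, 'e) tvec \<Rightarrow> ('a, 'e) tvec \<Rightarrow> real) \<Rightarrow> bool" where
  "associated A g W F \<longleftrightarrow>
     (\<forall>z\<in>tangent_bundle A. \<forall>u\<in>tangent_space A (fst z).
        g (fst z) (geometric_representative A W z) u + F (fst z) (snd z) u = 0)"

end

theory Submission
  imports Defs
begin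

text \<open>
  In the charts \<open>(q, dq)\<close> of \<open>TM\<close>, the equation \<open>i\<^sub>D \<omega>\<^sub>2 + dT = 0\<close> for a second order
  field is a linear system for its fibre component whose matrix is the Gram matrix of the metric. Its
  solutions are smooth, and they fit together under changes of charts because second derivatives are
  symmetric; so the geodesic field exists and is unique, and \<open>\<omega>\<^sub>2(D\<^sub>G, D\<^sub>G) = 0\<close> gives
  \<open>D\<^sub>G T = 0\<close>. Hence a force \<open>W\<close> is relativistic iff \<open>W T = 0\<close>, that is,
  \<open>T\<^sub>2(w(v), v) = 0\<close> for all \<open>v\<close>. For \<open>w = \<Phi>\<close> linear, this says that the bilinear form
  \<open>-T\<^sub>2(\<Phi> u, v)\<close> is alternating, and non-degeneracy of \<open>T\<^sub>2\<close> recovers \<open>\<Phi>\<close> from it, again by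
  solving a smooth linear system.
\<close>

section \<open>Calculus\<close>

text \<open>Two features of the encoding shape the proof. A tangent vector carries a component in
  every chart, so a field on \<open>TM\<close> has to be produced in all induced charts at once and
  shown to obey the transformation law of \<open>TM\<close>. On the other hand
  \<open>tangent_map\<close>, \<open>differential\<close> and \<open>exterior_derivative\<close> are
  evaluated in one arbitrarily chosen chart, so equations are verified there and reach the other
  charts through the transformation law. Smoothness of a solution of \<open>G x (f x) = h x\<close>
  is obtained without inverting matrices: differentiating the equation shows that each directional
  derivative of \<open>f\<close> solves a system with the same \<open>G\<close>, and an induction on
  the order follows. Composition in the C^k calculus is with bounded linear maps; this reaches far
  enough because the coordinate expressions on \<open>TM\<close> arise from functions of the
  position by inserting the velocity into linear slots.\<close>

lemma frechet_derivative_eqI: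
  "(f has_derivative f') (at x) \<Longrightarrow> frechet_derivative f (at x) v = f' v"
  by (metis frechet_derivative_at)

text \<open>Chart expressions contain \<open>chart_inv\<close>, whose values are meaningful on the
  chart range. Agreement with an explicit formula on an open set around the point is what can be
  proved there, and it determines the derivative.\<close>

lemma frechet_derivative_transform_fixed:
  assumes "(f has_derivative f') (at x)" "open S" "x \<in> S" "\<And>y. y \<in> S \<Longrightarrow> f y = g y"
  shows "frechet_derivative g (at x) = f'"
  using has_derivative_transform_within_open[OF assms] frechet_derivative_at by metis

lemma has_derivative_compose_fst:
  assumes "(f has_derivative f') (at x)"
  shows "((\<lambda>X. f (fst X)) has_derivative (\<lambda>k. f' (fst k))) (at (x, y))"
  using diff_chain_at[OF has_derivative_fst[OF has_derivative_ident], of f f' "(x, y)"] assms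
  by (simp add: o_def)

lemma linear_frechet_derivative_parameter:
  fixes L :: "'x::real_normed_vector \<Rightarrow> 'e::real_vector \<Rightarrow> 'f::real_normed_vector"
  assumes S: "open S" "x \<in> S" and lin: "\<And>y. y \<in> S \<Longrightarrow> linear (L y)"
    and diff: "\<And>e. (\<lambda>y. L y e) differentiable (at x)"
  shows "linear (\<lambda>e. frechet_derivative (\<lambda>y. L y e) (at x) k)"
proof (rule linearI)
  have D: "((\<lambda>y. L y e) has_derivative frechet_derivative (\<lambda>y. L y e) (at x)) (at x)" for e
    using diff frechet_derivative_works by blast
  fix a b :: 'e and r
  show "frechet_derivative (\<lambda>y. L y (a + b)) (at x) k
    = frechet_derivative (\<lambda>y. L y a) (at x) k + frechet_derivative (\<lambda>y. L y b) (at x) k"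
    by (rule fun_cong[OF frechet_derivative_transform_fixed[OF has_derivative_add[OF D D] S]])
      (simp add: linear_add[OF lin])
  show "frechet_derivative (\<lambda>y. L y (r *\<^sub>R a)) (at x) k = r *\<^sub>R frechet_derivative (\<lambda>y. L y a) (at x) k"
    by (rule fun_cong[OF frechet_derivative_transform_fixed[OF has_derivative_scaleR_right[OF D] S]])
      (simp add: linear_scale[OF lin])
qed

section \<open>Closure properties of C^k and smooth maps\<close>

lemma Ck_on_cong:
  assumes "open S" "\<And>x. x \<in> S \<Longrightarrow> f x = g x" "Ck_on k f S"
  shows "Ck_on k g S"
  using assms(2,3)
proof (induction k arbitrary: f g)
  case 0
  then show ?case by (simp cong: continuous_on_cong)
next
  case (Suc k)
  have f: "f differentiable (at x)" if "x \<in> S" for x using Suc.prems that by simp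
  have fr: "frechet_derivative f (at x) = frechet_derivative g (at x)" if "x \<in> S" for x
    using frechet_derivative_transform_within_open[OF f[OF that] assms(1) that Suc.prems(1)] .
  have "g differentiable (at x)" if "x \<in> S" for x
    using has_derivative_transform_within_open[of f _ x UNIV S g] assms(1) that Suc.prems(1) f[OF that]
    unfolding differentiable_def by blast
  moreover have "Ck_on k (\<lambda>x. frechet_derivative g (at x) v) S" for v
    by (rule Suc.IH[of "\<lambda>x. frechet_derivative f (at x) v"]) (use fr Suc.prems in auto)
  ultimately show ?case by simp
qed

text \<open>\<open>Ck_on\<close> speaks of \<open>frechet_derivative\<close>; with this rule any
  explicit formula for the derivative can take its place in the inductions below.\<close>

lemma Ck_on_SucI:
  assumes "open S" "\<And>x. x \<in> S \<Longrightarrow> (f has_derivative f' x) (at x)"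
    and "\<And>v. Ck_on k (\<lambda>x. f' x v) S"
  shows "Ck_on (Suc k) f S"
proof -
  have "Ck_on k (\<lambda>x. frechet_derivative f (at x) v) S" for v
    by (rule Ck_on_cong[OF assms(1) _ assms(3)[of v]])
      (use frechet_derivative_eqI[OF assms(2)] in auto)
  then show ?thesis
    using assms(2) by (auto simp: differentiable_def)
qed

lemma Ck_on_Suc_has_derivative:
  "Ck_on (Suc k) f S \<Longrightarrow> x \<in> S \<Longrightarrow> (f has_derivative frechet_derivative f (at x)) (at x)"
  by (simp add: frechet_derivative_works)

lemma Ck_on_Suc_imp_Ck_on: "Ck_on (Suc k) f S \<Longrightarrow> Ck_on k f S"
proof (induction k arbitrary: f)
  case 0
  then show ?case
    by (auto intro!: continuous_at_imp_continuous_on differentiable_imp_continuous_within)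
qed auto

lemma Ck_on_const: "open S \<Longrightarrow> Ck_on k (\<lambda>x. c) S"
proof (induction k arbitrary: c)
  case (Suc k)
  show ?case by (rule Ck_on_SucI[where f' = "\<lambda>x v. 0"]) (use Suc in auto)
qed simp

lemma Ck_on_bounded_linear:
  assumes "bounded_linear L" "open S" "Ck_on k f S"
  shows "Ck_on k (\<lambda>x. L (f x)) S"
  using assms(3)
proof (induction k arbitrary: f)
  case 0
  then show ?case
    using assms(1) by (auto intro: bounded_linear.continuous_on)
next
  case (Suc k)
  show ?case
    by (rule Ck_on_SucI[OF assms(2)
          bounded_linear.has_derivative[OF assms(1) Ck_on_Suc_has_derivative[OF Suc.prems]]])
      (use Suc in auto)
qed

lemma Ck_on_add:
  assumes "open S" "Ck_on k f S" "Ck_on k g S"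
  shows "Ck_on k (\<lambda>x. f x + g x) S"
  using assms(2,3)
proof (induction k arbitrary: f g)
  case 0
  then show ?case by (auto intro: continuous_on_add)
next
  case (Suc k)
  show ?case
    by (rule Ck_on_SucI[OF assms(1) has_derivative_add[OF
          Ck_on_Suc_has_derivative[OF Suc.prems(1)] Ck_on_Suc_has_derivative[OF Suc.prems(2)]]])
      (use Suc in auto)
qed

lemma Ck_on_bounded_bilinear:
  assumes "bounded_bilinear P" "open S" "Ck_on k f S" "Ck_on k g S"
  shows "Ck_on k (\<lambda>x. P (f x) (g x)) S"
  using assms(3,4)
proof (induction k arbitrary: f g)
  case 0
  then show ?case by (auto intro: bounded_bilinear.continuous_on[OF assms(1)])
next
  case (Suc k)
  \<comment> \<open>The product rule leaves one factor undifferentiated, so the induction hypothesis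
    needs \<open>f\<close> and \<open>g\<close> themselves to be of class C^k.\<close>
  have Ck: "Ck_on k f S" "Ck_on k g S"
    using Suc.prems Ck_on_Suc_imp_Ck_on by blast+
  have "Ck_on k (\<lambda>x. P (f x) (frechet_derivative g (at x) v)
      + P (frechet_derivative f (at x) v) (g x)) S" for v
    using Suc.prems by (intro Ck_on_add Suc.IH Ck assms(2)) simp_all
  with bounded_bilinear.FDERIV[OF assms(1)
          Ck_on_Suc_has_derivative[OF Suc.prems(1)] Ck_on_Suc_has_derivative[OF Suc.prems(2)]]
  show ?case by (rule Ck_on_SucI[OF assms(2)])
qed

text \<open>The derivative of the composite along \<open>v\<close> is a derivative of
  \<open>f\<close> in the fixed direction \<open>L v\<close>, again composed with \<open>L\<close>,
  so the induction closes on maps of the same shape. The inner maps used later are projections and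
  the identity.\<close>

lemma Ck_on_compose_bounded_linear:
  assumes "bounded_linear L" "open S" "L ` S \<subseteq> T" "Ck_on k f T"
  shows "Ck_on k (\<lambda>x. f (L x)) S"
  using assms(4)
proof (induction k arbitrary: f)
  case 0
  then show ?case
    using continuous_on_compose2[of T f S L] assms linear_continuous_on[OF assms(1)] by simp
next
  case (Suc k)
  have "((\<lambda>x. f (L x)) has_derivative (\<lambda>v. frechet_derivative f (at (L x)) (L v))) (at x)"
    if "x \<in> S" for x
  proof -
    have "(f has_derivative frechet_derivative f (at (L x))) (at (L x))"
      using that assms(3) Ck_on_Suc_has_derivative[OF Suc.prems] by auto
    from diff_chain_at[OF bounded_linear_imp_has_derivative[OF assms(1)] this]
    show ?thesis by (simp add: o_def)
  qed
  moreover have "Ck_on k (\<lambda>x. frechet_derivative f (at (L x)) (L v)) S" for v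
    using Suc.prems by (intro Suc.IH) simp
  ultimately show ?case by (rule Ck_on_SucI[OF assms(2)])
qed

lemma Ck_on_sum:
  assumes "open S" "\<And>i. i \<in> I \<Longrightarrow> Ck_on k (f i) S"
  shows "Ck_on k (\<lambda>x. \<Sum>i\<in>I. f i x) S"
  using assms(2)
  by (induction I rule: infinite_finite_induct) (auto intro!: Ck_on_const Ck_on_add assms(1))

lemma smooth_on_cong:
  "open S \<Longrightarrow> (\<And>x. x \<in> S \<Longrightarrow> f x = g x) \<Longrightarrow> smooth_on S f \<Longrightarrow> smooth_on S g"
  unfolding smooth_on_def using Ck_on_cong by blast

lemma smooth_on_const: "open S \<Longrightarrow> smooth_on S (\<lambda>x. c)"
  by (simp add: smooth_on_def Ck_on_const)

lemma smooth_on_bounded_linear: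
  "bounded_linear L \<Longrightarrow> open S \<Longrightarrow> smooth_on S f \<Longrightarrow> smooth_on S (\<lambda>x. L (f x))"
  by (simp add: smooth_on_def Ck_on_bounded_linear)

lemma smooth_on_compose_bounded_linear:
  "bounded_linear L \<Longrightarrow> open S \<Longrightarrow> L ` S \<subseteq> T \<Longrightarrow> smooth_on T f \<Longrightarrow> smooth_on S (\<lambda>x. f (L x))"
  unfolding smooth_on_def using Ck_on_compose_bounded_linear by blast

lemma smooth_on_add:
  "open S \<Longrightarrow> smooth_on S f \<Longrightarrow> smooth_on S g \<Longrightarrow> smooth_on S (\<lambda>x. f x + g x)"
  by (simp add: smooth_on_def Ck_on_add)

lemma smooth_on_minus: "open S \<Longrightarrow> smooth_on S f \<Longrightarrow> smooth_on S (\<lambda>x. - f x)"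
  by (rule smooth_on_bounded_linear[OF bounded_linear_minus[OF bounded_linear_ident]])

lemma smooth_on_diff:
  "open S \<Longrightarrow> smooth_on S f \<Longrightarrow> smooth_on S g \<Longrightarrow> smooth_on S (\<lambda>x. f x - g x)"
  using smooth_on_add[of S f "\<lambda>x. - g x"] smooth_on_minus[of S g] by simp

lemma smooth_on_bounded_bilinear:
  "bounded_bilinear P \<Longrightarrow> open S \<Longrightarrow> smooth_on S f \<Longrightarrow> smooth_on S g \<Longrightarrow>
    smooth_on S (\<lambda>x. P (f x) (g x))"
  by (simp add: smooth_on_def Ck_on_bounded_bilinear)

lemmas smooth_on_scaleR = smooth_on_bounded_bilinear[OF bounded_bilinear_scaleR]

lemma smooth_on_sum:
  "open S \<Longrightarrow> (\<And>i. i \<in> I \<Longrightarrow> smooth_on S (f i)) \<Longrightarrow> smooth_on S (\<lambda>x. \<Sum>i\<in>I. f i x)"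
  by (simp add: smooth_on_def Ck_on_sum)

lemma smooth_on_Pair:
  assumes "open S" "smooth_on S f" "smooth_on S g"
  shows "smooth_on S (\<lambda>x. (f x, g x))"
proof -
  have "smooth_on S (\<lambda>x. (f x, 0) + (0, g x))"
    by (intro smooth_on_add smooth_on_bounded_linear[of "\<lambda>x. (x, 0)"]
        smooth_on_bounded_linear[of "\<lambda>x. (0, x)"] assms bounded_linear_Pair
        bounded_linear_ident bounded_linear_zero)
  then show ?thesis by simp
qed

lemma smooth_on_ident: "open S \<Longrightarrow> smooth_on S (\<lambda>x. x)"
  unfolding smooth_on_def
proof
  fix k assume "open S"
  then show "Ck_on k (\<lambda>x. x) S"
    by (cases k) (auto intro!: Ck_on_SucI[where f' = "\<lambda>x v. v"] Ck_on_const continuous_on_id)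
qed

lemma smooth_on_linear: "bounded_linear L \<Longrightarrow> open S \<Longrightarrow> smooth_on S L"
  using smooth_on_bounded_linear[OF _ _ smooth_on_ident] .

lemma smooth_on_differentiable: "smooth_on S f \<Longrightarrow> x \<in> S \<Longrightarrow> f differentiable (at x)"
  using Ck_on.simps(2)[of 0 f S] unfolding smooth_on_def by blast

lemma smooth_on_has_derivative:
  "smooth_on S f \<Longrightarrow> x \<in> S \<Longrightarrow> (f has_derivative frechet_derivative f (at x)) (at x)"
  using smooth_on_differentiable frechet_derivative_works by blast

lemma smooth_on_frechet_derivative:
  "smooth_on S f \<Longrightarrow> smooth_on S (\<lambda>x. frechet_derivative f (at x) v)"
  unfolding smooth_on_def using Ck_on.simps(2) by blast

section \<open>Linear maps depending on a parameter\<close>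

lemma euclidean_linear_expansion:
  fixes u :: "'e::euclidean_space"
  assumes "linear L"
  shows "L u = (\<Sum>b\<in>Basis. (u \<bullet> b) *\<^sub>R L b)"
proof -
  have "L u = L (\<Sum>b\<in>Basis. (u \<bullet> b) *\<^sub>R b)" by (simp add: euclidean_representation)
  then show ?thesis by (simp only: linear_sum[OF assms] linear_scale[OF assms])
qed

text \<open>Expanding the argument in the basis turns the value into a finite sum of products of
  smooth functions; this is how smoothness for each fixed vector \<open>e\<close> extends to a
  moving argument \<open>u x\<close>.\<close>

lemma smooth_on_apply_linear:
  fixes u :: "'x::real_normed_vector \<Rightarrow> 'e::euclidean_space"
  assumes "open S" "\<And>x. x \<in> S \<Longrightarrow> linear (L x)" "\<And>e. smooth_on S (\<lambda>x. L x e)" "smooth_on S u"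
  shows "smooth_on S (\<lambda>x. L x (u x))"
proof (rule smooth_on_cong[OF assms(1)])
  fix x assume "x \<in> S"
  then show "(\<Sum>b\<in>Basis. (u x \<bullet> b) *\<^sub>R L x b) = L x (u x)"
    using euclidean_linear_expansion[OF assms(2)] by simp
next
  show "smooth_on S (\<lambda>x. \<Sum>b\<in>Basis. (u x \<bullet> b) *\<^sub>R L x b)"
    by (intro smooth_on_sum smooth_on_scaleR smooth_on_bounded_linear[of "\<lambda>x. x \<bullet> _"]
        bounded_linear_inner_left assms)
qed

text \<open>The product rule for a linear map and its argument, both moving. Finite dimension allows
  the differentiability of \<open>L\<close> to be stated for one vector at a time.\<close>

lemma differentiable_apply_linear_at:
  fixes L :: "'x::real_normed_vector \<Rightarrow> 'e::euclidean_space \<Rightarrow> 'f::real_normed_vector"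
    and u :: "'s::real_normed_vector \<Rightarrow> 'e"
  assumes S: "open S" "\<sigma> s \<in> S"
    and lin: "\<And>x. x \<in> S \<Longrightarrow> linear (L x)"
    and diff: "\<And>e. (\<lambda>x. L x e) differentiable (at (\<sigma> s))"
    and \<sigma>: "(\<sigma> has_derivative \<sigma>') (at s)"
    and u: "(u has_derivative u') (at s)"
  shows "((\<lambda>s. L (\<sigma> s) (u s)) has_derivative
     (\<lambda>k. frechet_derivative (\<lambda>x. L x (u s)) (at (\<sigma> s)) (\<sigma>' k) + L (\<sigma> s) (u' k))) (at s)"
proof -
  define D where "D e = frechet_derivative (\<lambda>x. L x e) (at (\<sigma> s))" for e
  have D: "((\<lambda>x. L x e) has_derivative D e) (at (\<sigma> s))" for e
    using diff unfolding D_def frechet_derivative_works .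
  have exp: "L x e = (\<Sum>b\<in>Basis. (e \<bullet> b) *\<^sub>R L x b)" if "x \<in> S" for x e
    using euclidean_linear_expansion[OF lin[OF that]] .
  have "((\<lambda>x. \<Sum>b\<in>Basis. (e \<bullet> b) *\<^sub>R L x b) has_derivative
      (\<lambda>k. \<Sum>b\<in>Basis. (e \<bullet> b) *\<^sub>R D b k)) (at (\<sigma> s))" for e
    by (intro has_derivative_sum has_derivative_scaleR_right D)
  from has_derivative_transform_within_open[OF this S, of _ "\<lambda>x. L x e" for e] exp
  \<comment> \<open>Linearity of the derivative in \<open>e\<close> is what later collects the sum
    over the basis back into one derivative at the vector \<open>u s\<close>.\<close>
  have Dexp: "D e k = (\<Sum>b\<in>Basis. (e \<bullet> b) *\<^sub>R D b k)" for e k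
    unfolding D_def by (intro frechet_derivative_eqI) (auto simp: D_def)
  have L\<sigma>: "((\<lambda>s. L (\<sigma> s) b) has_derivative (\<lambda>k. D b (\<sigma>' k))) (at s)" for b
    using diff_chain_at[OF \<sigma> D] by (simp add: o_def)
  have "((\<lambda>s. \<Sum>b\<in>Basis. (u s \<bullet> b) *\<^sub>R L (\<sigma> s) b) has_derivative
      (\<lambda>k. \<Sum>b\<in>Basis. (u s \<bullet> b) *\<^sub>R D b (\<sigma>' k) + (u' k \<bullet> b) *\<^sub>R L (\<sigma> s) b)) (at s)"
    by (intro has_derivative_sum has_derivative_scaleR L\<sigma> has_derivative_inner_left u)
  \<comment> \<open>The expansion is valid where \<open>\<sigma> x\<close> lies in \<open>S\<close>,
    and continuity of \<open>\<sigma>\<close> ensures this near \<open>s\<close>.\<close>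
  moreover have "\<forall>\<^sub>F x in at s. (\<Sum>b\<in>Basis. (u x \<bullet> b) *\<^sub>R L (\<sigma> x) b) = L (\<sigma> x) (u x)"
  proof -
    have "\<forall>\<^sub>F x in at s. \<sigma> x \<in> S"
      using has_derivative_continuous[OF \<sigma>] S by (simp add: continuous_within topological_tendstoD)
    then show ?thesis by eventually_elim (simp add: exp[symmetric])
  qed
  ultimately have "((\<lambda>s. L (\<sigma> s) (u s)) has_derivative
      (\<lambda>k. \<Sum>b\<in>Basis. (u s \<bullet> b) *\<^sub>R D b (\<sigma>' k) + (u' k \<bullet> b) *\<^sub>R L (\<sigma> s) b)) (at s)"
    by (rule has_derivative_transform_eventually) (use exp S in auto)
  then show ?thesis
    by (simp add: sum.distrib Dexp[symmetric] exp[OF S(2), symmetric] flip: D_def)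
qed

text \<open>The linear rule is used twice. First the second slot is the moving argument; then the
  pair of position and second argument becomes the parameter, and the first slot is the linear
  argument.\<close>

lemma differentiable_apply_bilinear_at:
  fixes B :: "'x::real_normed_vector \<Rightarrow> 'e::euclidean_space \<Rightarrow> 'e \<Rightarrow> 'f::real_normed_vector"
    and u v :: "'s::real_normed_vector \<Rightarrow> 'e"
  assumes S: "open S" "\<sigma> s \<in> S"
    and lin: "\<And>x a. x \<in> S \<Longrightarrow> linear (B x a)" "\<And>x b. x \<in> S \<Longrightarrow> linear (\<lambda>a. B x a b)"
    and diff: "\<And>a b. (\<lambda>x. B x a b) differentiable (at (\<sigma> s))"
    and \<sigma>: "(\<sigma> has_derivative \<sigma>') (at s)"
    and u: "(u has_derivative u') (at s)"
    and v: "(v has_derivative v') (at s)"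
  shows "((\<lambda>s. B (\<sigma> s) (u s) (v s)) has_derivative
     (\<lambda>k. frechet_derivative (\<lambda>x. B x (u s) (v s)) (at (\<sigma> s)) (\<sigma>' k)
          + B (\<sigma> s) (u' k) (v s) + B (\<sigma> s) (u s) (v' k))) (at s)"
proof -
  have 1: "((\<lambda>z. B (fst z) a (snd z)) has_derivative
      (\<lambda>k. frechet_derivative (\<lambda>x. B x a (v s)) (at (\<sigma> s)) (fst k) + B (\<sigma> s) a (snd k)))
      (at (\<sigma> s, v s))" for a
    using differentiable_apply_linear_at[of S fst "(\<sigma> s, v s)" "\<lambda>x. B x a" fst snd snd]
    by (simp add: S lin diff has_derivative_fst has_derivative_snd)
  have d1: "(\<lambda>z. B (fst z) a (snd z)) differentiable (at (\<sigma> s, v s))" for a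
    using 1 unfolding differentiable_def by blast
  have "((\<lambda>s. (\<lambda>z a. B (fst z) a (snd z)) (\<sigma> s, v s) (u s)) has_derivative
     (\<lambda>k. frechet_derivative (\<lambda>z. B (fst z) (u s) (snd z)) (at (\<sigma> s, v s)) (\<sigma>' k, v' k)
          + B (\<sigma> s) (u' k) (v s))) (at s)"
    using differentiable_apply_linear_at[of "S \<times> UNIV" "\<lambda>s. (\<sigma> s, v s)" s
        "\<lambda>z a. B (fst z) a (snd z)" "\<lambda>k. (\<sigma>' k, v' k)" u u', OF _ _ _ d1 has_derivative_Pair[OF \<sigma> v] u] S lin
    by (auto simp: open_Times)
  then show ?thesis
    by (simp add: frechet_derivative_eqI[OF 1] algebra_simps)
qed

section \<open>Linear systems with smooth coefficients\<close>

text \<open>Near \<open>x\<close> the factor \<open>\<psi> y\<close> is O(|y - x|) and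
  \<open>\<phi> y\<close> is o(1), so the product is o(|y - x|). Asking no more than continuity of
  \<open>\<phi>\<close> is essential: it will be a coordinate of the increment of a solution whose
  differentiability is still to be shown.\<close>

lemma has_derivative_zero_product:
  fixes \<phi> :: "'x::real_normed_vector \<Rightarrow> real" and \<psi> :: "'x \<Rightarrow> 'f::real_normed_vector"
  assumes "continuous (at x) \<phi>" "\<phi> x = 0" "\<psi> differentiable (at x)" "\<psi> x = 0"
  shows "((\<lambda>y. \<phi> y *\<^sub>R \<psi> y) has_derivative (\<lambda>v. 0)) (at x)"
proof -
  obtain L where L: "(\<psi> has_derivative L) (at x)"
    using assms(3) by (auto simp: differentiable_def)
  then have bl: "bounded_linear L" by (rule has_derivative_bounded_linear)
  obtain K where K: "K > 0" "\<And>v. norm (L v) \<le> norm v * K"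
    using bounded_linear.pos_bounded[OF bl] by blast
  have \<phi>: "(\<phi> \<longlongrightarrow> 0) (at x)"
    using assms(1,2) by (simp add: continuous_within)
  have *: "((\<lambda>y. norm (\<psi> y - \<psi> x - L (y - x)) / norm (y - x)) \<longlongrightarrow> 0) (at x)"
    using L by (simp add: has_derivative_iff_norm)
  \<comment> \<open>The bound splits \<open>\<psi>\<close> into its first order remainder and its
    linear part, the latter at most \<open>K\<close> times the distance.\<close>
  have "((\<lambda>y. \<bar>\<phi> y\<bar> * (norm (\<psi> y - \<psi> x - L (y - x)) / norm (y - x) + K)) \<longlongrightarrow> \<bar>0\<bar> * (0 + K)) (at x)"
    by (intro tendsto_intros \<phi> *)
  then have lim: "((\<lambda>y. \<bar>\<phi> y\<bar> * (norm (\<psi> y - \<psi> x - L (y - x)) / norm (y - x) + K)) \<longlongrightarrow> 0) (at x)"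
    by simp
  have "((\<lambda>y. norm (\<phi> y *\<^sub>R \<psi> y) / norm (y - x)) \<longlongrightarrow> 0) (at x)"
  proof (rule tendsto_sandwich[OF _ _ tendsto_const lim])
    show "\<forall>\<^sub>F y in at x. norm (\<phi> y *\<^sub>R \<psi> y) / norm (y - x)
        \<le> \<bar>\<phi> y\<bar> * (norm (\<psi> y - \<psi> x - L (y - x)) / norm (y - x) + K)"
    \<comment> \<open>Division by the distance needs \<open>y\<close> different from
      \<open>x\<close>, which holds in the punctured filter \<open>at x\<close>.\<close>
    proof (rule eventually_at_in_open'[of UNIV, THEN eventually_rev_mp, OF open_UNIV UNIV_I],
        rule eventually_rev_mp[OF eventually_neq_at_within[of x x UNIV]], intro always_eventually allI impI)
      fix y assume "y \<noteq> x"
      have "norm (\<psi> y) \<le> norm (\<psi> y - L (y - x)) + norm (L (y - x))"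
        by (metis diff_add_cancel norm_triangle_ineq)
      also have "\<dots> \<le> norm (\<psi> y - L (y - x)) + norm (y - x) * K"
        using K(2) by simp
      finally have "norm (\<psi> y) / norm (y - x) \<le> norm (\<psi> y - \<psi> x - L (y - x)) / norm (y - x) + K"
        using \<open>y \<noteq> x\<close> assms(4) by (simp add: field_simps)
      from mult_left_mono[OF this abs_ge_zero[of "\<phi> y"]]
      show "norm (\<phi> y *\<^sub>R \<psi> y) / norm (y - x)
        \<le> \<bar>\<phi> y\<bar> * (norm (\<psi> y - \<psi> x - L (y - x)) / norm (y - x) + K)"
        by simp
    qed
  qed auto
  then show ?thesis
    by (simp add: has_derivative_iff_norm assms)
qed

text \<open>An injective \<open>G x\<close> is bounded below by some \<open>c > 0\<close>. Where
  \<open>G y\<close> differs from \<open>G x\<close> by less than \<open>c\<close> in operator norm,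
  the equation bounds the increment of \<open>f\<close> by quantities that involve only
  \<open>h\<close>, \<open>G\<close> and the fixed value \<open>f x\<close>, so no a priori control
  of \<open>f y\<close> is needed.\<close>

lemma linear_solve_continuous_at:
  fixes G :: "'x::real_normed_vector \<Rightarrow> 'e::euclidean_space \<Rightarrow> 'e"
  assumes S: "open S" "x \<in> S"
    and lin: "\<And>y. y \<in> S \<Longrightarrow> linear (G y)" and inj: "inj (G x)"
    and G: "\<And>e. continuous (at x) (\<lambda>y. G y e)" and h: "continuous (at x) h"
    and eq: "\<And>y. y \<in> S \<Longrightarrow> G y (f y) = h y"
  shows "continuous (at x) f"
proof -
  obtain c where c: "c > 0" "\<And>u. norm (G x u) \<ge> c * norm u"
    using linear_inj_bounded_below_pos[OF lin[OF S(2)] inj] by (metis mult.commute)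
  \<comment> \<open>This sum bounds the operator norm of \<open>G y - G x\<close>, since each
    coordinate of \<open>u\<close> is at most \<open>norm u\<close>, and it tends to zero because it
    has finitely many terms.\<close>
  define \<epsilon> where "\<epsilon> y = (\<Sum>b\<in>Basis. norm (G y b - G x b))" for y
  have \<epsilon>: "norm (G y u - G x u) \<le> \<epsilon> y * norm u" if "y \<in> S" for y u
  proof -
    have "G y u - G x u = (\<Sum>b\<in>Basis. (u \<bullet> b) *\<^sub>R (G y b - G x b))"
      using euclidean_linear_expansion[OF lin[OF that], of u]
        euclidean_linear_expansion[OF lin[OF S(2)], of u]
      by (simp add: scaleR_diff_right sum_subtractf)
    also have "norm \<dots> \<le> (\<Sum>b\<in>Basis. norm u * norm (G y b - G x b))"
      by (rule sum_norm_le) (simp add: Basis_le_norm mult_right_mono)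
    finally show ?thesis by (simp add: \<epsilon>_def sum_distrib_left mult.commute)
  qed
  have \<epsilon>0: "(\<epsilon> \<longlongrightarrow> 0) (at x)"
  proof -
    have "(\<epsilon> \<longlongrightarrow> (\<Sum>b\<in>(Basis::'e set). norm (G x b - G x b))) (at x)"
      unfolding \<epsilon>_def using G by (intro tendsto_intros) (simp add: continuous_within)
    then show ?thesis by simp
  qed
  have h0: "((\<lambda>y. norm (h y - h x)) \<longlongrightarrow> 0) (at x)"
    using h by (simp add: continuous_within LIM_zero tendsto_norm_zero)
  have lim: "((\<lambda>y. (norm (h y - h x) + \<epsilon> y * norm (f x)) / (c - \<epsilon> y)) \<longlongrightarrow> 0) (at x)"
    using tendsto_divide[OF tendsto_add[OF h0 tendsto_mult_right[OF \<epsilon>0, of "norm (f x)"]]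
        tendsto_diff[OF tendsto_const \<epsilon>0, of c]] c(1) by simp
  have "((\<lambda>y. norm (f y - f x)) \<longlongrightarrow> 0) (at x)"
  proof (rule tendsto_sandwich[OF _ _ tendsto_const lim])
    show "\<forall>\<^sub>F y in at x. norm (f y - f x) \<le> (norm (h y - h x) + \<epsilon> y * norm (f x)) / (c - \<epsilon> y)"
      using order_tendstoD(2)[OF \<epsilon>0 c(1)] eventually_at_in_open'[OF S]
    proof eventually_elim
      case (elim y)
      \<comment> \<open>The equation is used at \<open>y\<close> and at \<open>x\<close>; the
        discrepancy between \<open>G y\<close> and \<open>G x\<close> is left on \<open>f y\<close>,
        whose norm is then split into the increment, to be absorbed on the left, and
        \<open>norm (f x)\<close>.\<close>
      have e: "G x (f y - f x) = (h y - h x) - (G y (f y) - G x (f y))"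
        using eq[OF elim(2)] eq[OF S(2)] linear_diff[OF lin[OF S(2)]] by simp
      have "c * norm (f y - f x) \<le> norm (h y - h x) + norm (G y (f y) - G x (f y))"
        using c(2)[of "f y - f x"] norm_triangle_ineq4[of "h y - h x" "G y (f y) - G x (f y)"]
        unfolding e by linarith
      also have "norm (G y (f y) - G x (f y)) \<le> \<epsilon> y * (norm (f y - f x) + norm (f x))"
      proof -
        have "norm (f y) \<le> norm (f y - f x) + norm (f x)"
          by (metis diff_add_cancel norm_triangle_ineq)
        moreover have "\<epsilon> y \<ge> 0" unfolding \<epsilon>_def by (simp add: sum_nonneg)
        ultimately show ?thesis using \<epsilon>[OF elim(2), of "f y"] mult_left_mono order_trans by blast
      qed
      finally have "(c - \<epsilon> y) * norm (f y - f x) \<le> norm (h y - h x) + \<epsilon> y * norm (f x)"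
        by (simp add: algebra_simps)
      then show ?case using elim(1) by (simp add: pos_le_divide_eq mult.commute)
    qed
  qed auto
  then show ?thesis
    by (simp add: continuous_within LIM_zero_iff tendsto_norm_zero_iff)
qed

text \<open>
  Multiplied by \<open>G x\<close>, the increment \<open>f y - f x\<close> becomes \<open>h y - G y (f x)\<close> minus
  \<open>(G y - G x) (f y - f x)\<close>, and the latter has derivative zero at \<open>x\<close> as soon as \<open>f\<close> is continuous.
\<close>

lemma linear_solve_has_derivative:
  fixes G :: "'x::real_normed_vector \<Rightarrow> 'e::euclidean_space \<Rightarrow> 'e"
  assumes S: "open S" "x \<in> S"
    and lin: "\<And>y. y \<in> S \<Longrightarrow> linear (G y)" and inj: "inj (G x)"
    and G: "\<And>e. (\<lambda>y. G y e) differentiable (at x)" and h: "h differentiable (at x)"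
    and eq: "\<And>y. y \<in> S \<Longrightarrow> G y (f y) = h y"
  obtains f' where "(f has_derivative f') (at x)"
    and "\<And>v. G x (f' v) = frechet_derivative h (at x) v - frechet_derivative (\<lambda>y. G y (f x)) (at x) v"
proof -
  obtain L where L: "linear L" "L \<circ> G x = id"
    using linear_injective_left_inverse[OF lin[OF S(2)] inj] by blast
  have surj: "surj (G x)" using linear_inj_imp_surj[OF lin[OF S(2)] inj] .
  have LG: "L (G x u) = u" for u using L(2) by (metis comp_apply id_apply)
  have GL: "G x (L u) = u" for u using surj LG by (metis surj_f_inv_f)
  have f: "continuous (at x) f"
    using linear_solve_continuous_at[where G = G and h = h and f = f, OF S lin inj _ _ eq] G h differentiable_imp_continuous_within
    by blast
  define f' where "f' v = L (frechet_derivative h (at x) v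
      - frechet_derivative (\<lambda>y. G y (f x)) (at x) v)" for v
  have R: "((\<lambda>y. \<Sum>b\<in>Basis. ((f y - f x) \<bullet> b) *\<^sub>R (G y b - G x b)) has_derivative (\<lambda>v. \<Sum>b\<in>(Basis::'e set). 0)) (at x)"
    by (intro has_derivative_sum has_derivative_zero_product continuous_intros f
        differentiable_diff G differentiable_const) auto
  have "((\<lambda>y. h y - G y (f x) - (\<Sum>b\<in>Basis. ((f y - f x) \<bullet> b) *\<^sub>R (G y b - G x b))) has_derivative
      (\<lambda>v. frechet_derivative h (at x) v - frechet_derivative (\<lambda>y. G y (f x)) (at x) v
        - (\<Sum>b\<in>(Basis::'e set). 0))) (at x)"
    using h G by (intro has_derivative_diff R) (simp_all add: frechet_derivative_works)
  then have "((\<lambda>y. L (h y - G y (f x) - (\<Sum>b\<in>Basis. ((f y - f x) \<bullet> b) *\<^sub>R (G y b - G x b))) + f x)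
      has_derivative f') (at x)"
    using has_derivative_add[OF bounded_linear.has_derivative[OF L(1)[unfolded linear_conv_bounded_linear]]
        has_derivative_const[of "f x"]] by (simp add: f'_def[abs_def])
  then have "(f has_derivative f') (at x)"
  proof (rule has_derivative_transform_within_open[OF _ S])
    fix y assume y: "y \<in> S"
    have "(\<Sum>b\<in>Basis. ((f y - f x) \<bullet> b) *\<^sub>R (G y b - G x b)) = G y (f y - f x) - G x (f y - f x)"
      using euclidean_linear_expansion[OF lin[OF y], of "f y - f x"]
        euclidean_linear_expansion[OF lin[OF S(2)], of "f y - f x"]
      by (simp add: scaleR_diff_right sum_subtractf)
    then show "L (h y - G y (f x) - (\<Sum>b\<in>Basis. ((f y - f x) \<bullet> b) *\<^sub>R (G y b - G x b))) + f x = f y"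
      using LG[of "f y - f x"] linear_diff[OF lin[OF y]] by (simp flip: eq[OF y])
  qed
  then show ?thesis using that GL unfolding f'_def by blast
qed

text \<open>Differentiating \<open>G y (f y) = h y\<close> along \<open>v\<close> gives a system
  with the same \<open>G\<close> for the derivative of \<open>f\<close>. Its right-hand side
  contains \<open>f\<close> itself, which is C^k by the induction hypothesis; hence the induction
  runs over all pairs \<open>f\<close> and \<open>h\<close>.\<close>

lemma Ck_on_linear_solve:
  fixes G :: "'x::real_normed_vector \<Rightarrow> 'e::euclidean_space \<Rightarrow> 'e"
  assumes S: "open S"
    and lin: "\<And>y. y \<in> S \<Longrightarrow> linear (G y)" and inj: "\<And>y. y \<in> S \<Longrightarrow> inj (G y)"
    and G: "\<And>e. smooth_on S (\<lambda>y. G y e)"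
    and h: "Ck_on k h S"
    and eq: "\<And>y. y \<in> S \<Longrightarrow> G y (f y) = h y"
  shows "Ck_on k f S"
  using h eq
proof (induction k arbitrary: f h)
  case 0
  have "continuous (at x) f" if "x \<in> S" for x
  proof (rule linear_solve_continuous_at[where G = G and h = h and f = f, OF S that lin inj[OF that]])
    show "continuous (at x) (\<lambda>y. G y e)" for e
      using differentiable_imp_continuous_within smooth_on_differentiable[OF G that] by blast
    show "continuous (at x) h"
      using 0(1) S that by (simp add: continuous_on_eq_continuous_at)
  qed (simp_all add: 0(2))
  then show ?case by (simp add: continuous_at_imp_continuous_on)
next
  case (Suc k)
  have f: "Ck_on k f S" using Suc.IH[OF Ck_on_Suc_imp_Ck_on] Suc.prems by blast
  have "\<exists>f'. (f has_derivative f') (at x) \<and> (\<forall>v. G x (f' v)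
      = frechet_derivative h (at x) v - frechet_derivative (\<lambda>y. G y (f x)) (at x) v)"
    if "x \<in> S" for x
  proof -
    have "h differentiable (at x)" using Suc.prems(1) that by simp
    from linear_solve_has_derivative[where G = G and f = f, OF S that lin inj[OF that]
      smooth_on_differentiable[OF G that] this Suc.prems(2)] show ?thesis by metis
  qed
  then obtain f' where f': "\<And>x. x \<in> S \<Longrightarrow> (f has_derivative f' x) (at x)"
    "\<And>x v. x \<in> S \<Longrightarrow> G x (f' x v)
      = frechet_derivative h (at x) v - frechet_derivative (\<lambda>y. G y (f x)) (at x) v"
    by metis
  have "Ck_on k (\<lambda>x. f' x v) S" for v
  proof (rule Suc.IH)
    \<comment> \<open>The vector \<open>f x\<close> is frozen inside the derivative of
      \<open>G y (f x)\<close>. Expanding it in the basis shows the right-hand side as a combination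
      of products of C^k functions of \<open>x\<close>.\<close>
    show "G x (f' x v) = frechet_derivative h (at x) v + - (\<Sum>b\<in>Basis. (f x \<bullet> b) *\<^sub>R
        frechet_derivative (\<lambda>y. G y b) (at x) v)" if "x \<in> S" for x
    proof -
      have "((\<lambda>y. \<Sum>b\<in>Basis. (f x \<bullet> b) *\<^sub>R G y b) has_derivative (\<lambda>v. \<Sum>b\<in>Basis. (f x \<bullet> b) *\<^sub>R
        frechet_derivative (\<lambda>y. G y b) (at x) v)) (at x)"
        by (intro has_derivative_sum has_derivative_scaleR_right smooth_on_has_derivative[OF G that])
      from has_derivative_transform_within_open[OF this S that, of "\<lambda>y. G y (f x)"]
      show ?thesis
        using f'(2)[OF that] euclidean_linear_expansion[OF lin] by (simp add: frechet_derivative_eqI)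
    qed
    have "bounded_linear (uminus :: 'e \<Rightarrow> 'e)" by (simp add: bounded_linear_minus bounded_linear_ident)
    moreover have "Ck_on k (\<lambda>x. \<Sum>b\<in>Basis. (f x \<bullet> b) *\<^sub>R frechet_derivative (\<lambda>y. G y b) (at x) v) S"
      using G smooth_on_frechet_derivative unfolding smooth_on_def
      by (intro Ck_on_sum S Ck_on_bounded_bilinear[OF bounded_bilinear_scaleR]
          Ck_on_bounded_linear[of "\<lambda>x. x \<bullet> _"] bounded_linear_inner_left f) blast
    ultimately show "Ck_on k (\<lambda>x. frechet_derivative h (at x) v + - (\<Sum>b\<in>Basis. (f x \<bullet> b) *\<^sub>R
        frechet_derivative (\<lambda>y. G y b) (at x) v)) S"
      using Suc.prems(1) S by (intro Ck_on_add S Ck_on_bounded_linear[of uminus]) simp_all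
  qed
  then show ?case using Ck_on_SucI[OF S f'(1)] by blast
qed

lemma smooth_on_linear_solve:
  fixes G :: "'x::real_normed_vector \<Rightarrow> 'e::euclidean_space \<Rightarrow> 'e"
  assumes "open S" "\<And>y. y \<in> S \<Longrightarrow> linear (G y)" "\<And>y. y \<in> S \<Longrightarrow> inj (G y)"
    and "\<And>e. smooth_on S (\<lambda>y. G y e)" "smooth_on S h" "\<And>y. y \<in> S \<Longrightarrow> G y (f y) = h y"
  shows "smooth_on S f"
  using Ck_on_linear_solve[OF assms(1-4) _ assms(6)] assms(5) unfolding smooth_on_def by blast

section \<open>Symmetry of second derivatives\<close>

text \<open>The mean value theorem is applied along \<open>a\<close> to the difference of
  \<open>\<phi>\<close> on two opposite sides of the parallelogram, then along \<open>b\<close> to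
  the resulting difference of directional derivatives. The second difference is unchanged when
  \<open>a\<close> and \<open>b\<close> are exchanged, which makes the two mixed derivatives
  comparable.\<close>

lemma second_difference_mean_value:
  fixes \<phi> :: "'e::real_normed_vector \<Rightarrow> real"
  assumes t: "t > 0"
    and S: "\<And>r s. r \<in> {0..t} \<Longrightarrow> s \<in> {0..t} \<Longrightarrow> x + r *\<^sub>R a + s *\<^sub>R b \<in> S"
    and d1: "\<And>y. y \<in> S \<Longrightarrow> (\<phi> has_derivative \<phi>' y) (at y)"
    and d2: "\<And>y. y \<in> S \<Longrightarrow> ((\<lambda>y. \<phi>' y a) has_derivative \<psi> y) (at y)"
  obtains r s where "r \<in> {0..t}" "s \<in> {0..t}"
    "\<phi> (x + t *\<^sub>R a + t *\<^sub>R b) - \<phi> (x + t *\<^sub>R a) - \<phi> (x + t *\<^sub>R b) + \<phi> x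
      = t * t * \<psi> (x + r *\<^sub>R a + s *\<^sub>R b) b"
proof -
  have along: "((\<lambda>s. f (y + s *\<^sub>R v)) has_real_derivative f' v) (at s)"
    if f: "(f has_derivative f') (at (y + s *\<^sub>R v))" for f f' and y v :: 'e and s
  proof -
    have "((\<lambda>s. y + s *\<^sub>R v) has_derivative (\<lambda>s. s *\<^sub>R v)) (at s)"
      by (auto intro!: derivative_eq_intros)
    from diff_chain_at[OF this f] show ?thesis
      using linear_scale[OF has_derivative_linear[OF f]]
      by (simp add: o_def has_field_derivative_def mult_commute_abs)
  qed
  have "\<exists>r. 0 < r \<and> r < t \<and> (\<phi> (x + t *\<^sub>R b + t *\<^sub>R a) - \<phi> (x + t *\<^sub>R a))
      - (\<phi> (x + t *\<^sub>R b + 0 *\<^sub>R a) - \<phi> (x + 0 *\<^sub>R a))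
      = (t - 0) * (\<phi>' (x + t *\<^sub>R b + r *\<^sub>R a) a - \<phi>' (x + r *\<^sub>R a) a)"
  proof (rule MVT2[OF t, where f = "\<lambda>r. \<phi> (x + t *\<^sub>R b + r *\<^sub>R a) - \<phi> (x + r *\<^sub>R a)"
        and f' = "\<lambda>r. \<phi>' (x + t *\<^sub>R b + r *\<^sub>R a) a - \<phi>' (x + r *\<^sub>R a) a"], rule DERIV_diff)
    fix r assume r: "0 \<le> r" "r \<le> t"
    have "x + t *\<^sub>R b + r *\<^sub>R a \<in> S" "x + r *\<^sub>R a \<in> S"
      using S[of r t] S[of r 0] r t by (simp_all add: add_ac)
    from this[THEN d1, THEN along]
    show "((\<lambda>r. \<phi> (x + t *\<^sub>R b + r *\<^sub>R a)) has_real_derivative \<phi>' (x + t *\<^sub>R b + r *\<^sub>R a) a) (at r)"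
      "((\<lambda>r. \<phi> (x + r *\<^sub>R a)) has_real_derivative \<phi>' (x + r *\<^sub>R a) a) (at r)" .
  qed
  then obtain r where r: "0 < r" "r < t" "(\<phi> (x + t *\<^sub>R b + t *\<^sub>R a) - \<phi> (x + t *\<^sub>R a))
      - (\<phi> (x + t *\<^sub>R b) - \<phi> x) = t * (\<phi>' (x + r *\<^sub>R a + t *\<^sub>R b) a - \<phi>' (x + r *\<^sub>R a) a)"
    by (auto simp: algebra_simps)
  have "\<exists>s. 0 < s \<and> s < t \<and> \<phi>' (x + r *\<^sub>R a + t *\<^sub>R b) a - \<phi>' (x + r *\<^sub>R a + 0 *\<^sub>R b) a
      = (t - 0) * \<psi> (x + r *\<^sub>R a + s *\<^sub>R b) b"
    by (rule MVT2[OF t, where f = "\<lambda>s. \<phi>' (x + r *\<^sub>R a + s *\<^sub>R b) a"], intro along d2 S) (use r in auto)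
  then obtain s where s: "0 < s" "s < t"
    "\<phi>' (x + r *\<^sub>R a + t *\<^sub>R b) a - \<phi>' (x + r *\<^sub>R a) a = t * \<psi> (x + r *\<^sub>R a + s *\<^sub>R b) b"
    by auto
  show ?thesis
    by (rule that[of r s]) (use r s in \<open>auto simp: algebra_simps\<close>)
qed

text \<open>One second difference, divided by \<open>t * t\<close>, is a value of both mixed
  derivatives, at two points near \<open>x\<close>. If they differed at \<open>x\<close>, continuity
  would keep each within half the gap of its value at \<open>x\<close>, which excludes a common
  value.\<close>

lemma second_derivative_symmetric_real:
  fixes \<phi> :: "'e::real_normed_vector \<Rightarrow> real"
  assumes "open S" "x \<in> S" "smooth_on S \<phi>"
  shows "frechet_derivative (\<lambda>y. frechet_derivative \<phi> (at y) a) (at x) b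
       = frechet_derivative (\<lambda>y. frechet_derivative \<phi> (at y) b) (at x) a"
proof (rule ccontr)
  define P where "P a b y = frechet_derivative (\<lambda>y. frechet_derivative \<phi> (at y) a) (at y) b" for a b y
  assume "\<not> ?thesis"
  then have pos: "0 < dist (P a b x) (P b a x) / 2" unfolding P_def by simp
  have cont: "continuous (at x) (P a b)" for a b
    using smooth_on_frechet_derivative[OF smooth_on_frechet_derivative[OF assms(3)]]
      smooth_on_differentiable assms(2) unfolding P_def
    by (blast intro: differentiable_imp_continuous_within)
  have "\<exists>d>0. \<forall>y. dist y x < d \<longrightarrow> dist (P a b y) (P a b x) < dist (P a b x) (P b a x) / 2"
    using cont[of a b] pos unfolding continuous_at_eps_delta by blast
  moreover have "\<exists>d>0. \<forall>y. dist y x < d \<longrightarrow> dist (P b a y) (P b a x) < dist (P a b x) (P b a x) / 2"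
    using cont[of b a] pos unfolding continuous_at_eps_delta by blast
  moreover have "\<exists>d>0. \<forall>y. dist y x < d \<longrightarrow> y \<in> S"
    using assms(1,2) open_dist by blast
  ultimately obtain d where d: "d > 0" "\<And>y. dist y x < d \<Longrightarrow> y \<in> S"
    "\<And>y. dist y x < d \<Longrightarrow> dist (P a b y) (P a b x) < dist (P a b x) (P b a x) / 2"
    "\<And>y. dist y x < d \<Longrightarrow> dist (P b a y) (P b a x) < dist (P a b x) (P b a x) / 2"
    by (metis (no_types) min_less_iff_conj)
  \<comment> \<open>Small enough to keep the parallelogram in the ball of radius \<open>d\<close>;
    the summand 1 keeps the denominator positive when \<open>a\<close> and \<open>b\<close>
    vanish.\<close>
  define t where "t = d / (2 * (norm a + norm b + 1))"
  have t: "t > 0" "t * (norm a + norm b) < d"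
    using d(1) by (simp_all add: t_def field_simps add_nonneg_pos add_pos_nonneg)
  have near: "dist (x + r *\<^sub>R v + s *\<^sub>R w) x < d"
    if "r \<in> {0..t}" "s \<in> {0..t}" "norm v + norm w = norm a + norm b" for r s v w
  proof -
    have "dist (x + r *\<^sub>R v + s *\<^sub>R w) x = norm (r *\<^sub>R v + s *\<^sub>R w)"
      by (simp add: dist_norm)
    also have "\<dots> \<le> r * norm v + s * norm w"
      using norm_triangle_ineq[of "r *\<^sub>R v" "s *\<^sub>R w"] that by simp
    also have "\<dots> \<le> t * norm v + t * norm w"
      using that by (intro add_mono mult_right_mono) auto
    also have "\<dots> = t * (norm a + norm b)" using that(3) by (metis distrib_left)
    finally show ?thesis using t by simp
  qed
  have der: "(\<phi> has_derivative frechet_derivative \<phi> (at y)) (at y)"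
    "((\<lambda>y. frechet_derivative \<phi> (at y) v) has_derivative (\<lambda>w. P v w y)) (at y)"
    if "y \<in> S" for y v
    using smooth_on_has_derivative that assms(3) smooth_on_frechet_derivative[OF assms(3)]
    unfolding P_def by blast+
  obtain r s where rs: "r \<in> {0..t}" "s \<in> {0..t}"
    "\<phi> (x + t *\<^sub>R a + t *\<^sub>R b) - \<phi> (x + t *\<^sub>R a) - \<phi> (x + t *\<^sub>R b) + \<phi> x
      = t * t * P a b (x + r *\<^sub>R a + s *\<^sub>R b)"
    by (rule second_difference_mean_value[OF t(1), of x a b S \<phi> _ "\<lambda>y w. P a w y"])
      (use der near d(2) in auto)
  obtain r' s' where rs': "r' \<in> {0..t}" "s' \<in> {0..t}"
    "\<phi> (x + t *\<^sub>R b + t *\<^sub>R a) - \<phi> (x + t *\<^sub>R b) - \<phi> (x + t *\<^sub>R a) + \<phi> x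
      = t * t * P b a (x + r' *\<^sub>R b + s' *\<^sub>R a)"
    by (rule second_difference_mean_value[OF t(1), of x b a S \<phi> _ "\<lambda>y w. P b w y"])
      (use der near d(2) in auto)
  have "P a b (x + r *\<^sub>R a + s *\<^sub>R b) = P b a (x + r' *\<^sub>R b + s' *\<^sub>R a)"
  proof -
    have "t * t * P a b (x + r *\<^sub>R a + s *\<^sub>R b) = t * t * P b a (x + r' *\<^sub>R b + s' *\<^sub>R a)"
      using rs(3) rs'(3) by (simp add: algebra_simps)
    then show ?thesis using t(1) by simp
  qed
  moreover have "dist (P a b (x + r *\<^sub>R a + s *\<^sub>R b)) (P a b x) < dist (P a b x) (P b a x) / 2"
    by (intro d(3) near rs) simp
  moreover have "dist (P b a (x + r' *\<^sub>R b + s' *\<^sub>R a)) (P b a x) < dist (P a b x) (P b a x) / 2"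
    by (intro d(4) near rs') simp
  ultimately show False
    by (metis dist_commute dist_triangle_half_l less_irrefl)
qed

lemma second_derivative_symmetric:
  fixes f :: "'e::real_normed_vector \<Rightarrow> 'f::euclidean_space"
  assumes "open S" "x \<in> S" "smooth_on S f"
  shows "frechet_derivative (\<lambda>y. frechet_derivative f (at y) a) (at x) b
       = frechet_derivative (\<lambda>y. frechet_derivative f (at y) b) (at x) a"
proof (rule euclidean_eqI)
  fix i :: 'f assume "i \<in> Basis"
  have fi: "frechet_derivative (\<lambda>y. f y \<bullet> i) (at y) v = frechet_derivative f (at y) v \<bullet> i" if "y \<in> S" for y v
    by (intro frechet_derivative_eqI has_derivative_inner_left smooth_on_has_derivative[OF assms(3) that])
  have "frechet_derivative (\<lambda>y. frechet_derivative (\<lambda>y. f y \<bullet> i) (at y) v) (at x) w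
      = frechet_derivative (\<lambda>y. frechet_derivative f (at y) v) (at x) w \<bullet> i" for v w
    by (rule frechet_derivative_eqI, rule has_derivative_transform_within_open[OF _ assms(1,2) fi[symmetric]])
      (intro has_derivative_inner_left
        smooth_on_has_derivative[OF smooth_on_frechet_derivative[OF assms(3)] assms(2)], assumption)
  then show "frechet_derivative (\<lambda>y. frechet_derivative f (at y) a) (at x) b \<bullet> i
      = frechet_derivative (\<lambda>y. frechet_derivative f (at y) b) (at x) a \<bullet> i"
    using second_derivative_symmetric_real[OF assms(1,2)
        smooth_on_bounded_linear[OF bounded_linear_inner_left assms(1,3)], of i a b] by simp
qed

section \<open>Atlases\<close>

lemma chart_range_inverse:
  assumes "x \<in> chart_range c"
  shows "chart_inv c x \<in> fst c" "snd c (chart_inv c x) = x"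
  using assms unfolding chart_range_def chart_inv_def
  by (auto intro: inv_into_into f_inv_into_f)

text \<open>Tangent vectors involve first derivatives of transition maps. Stated at this level, the
  same lemmas serve both the atlas of \<open>M\<close> and the atlas of \<open>TM\<close>.\<close>

locale differentiable_atlas =
  fixes A :: "('a, 'e::real_normed_vector) chart set"
  assumes inj_on_chart: "c \<in> A \<Longrightarrow> inj_on (snd c) (fst c)"
    and open_overlap: "c \<in> A \<Longrightarrow> d \<in> A \<Longrightarrow> open (snd c ` (fst c \<inter> fst d))"
    and transition_differentiable: "c \<in> A \<Longrightarrow> d \<in> A \<Longrightarrow> p \<in> fst c \<Longrightarrow> p \<in> fst d \<Longrightarrow>
      transition c d differentiable (at (snd c p))"
begin

abbreviation jac :: "('a, 'e) chart \<Rightarrow> ('a, 'e) chart \<Rightarrow> 'a \<Rightarrow> 'e \<Rightarrow> 'e" where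
  "jac c d p \<equiv> frechet_derivative (transition c d) (at (snd c p))"

lemma chart_inv_chart: "c \<in> A \<Longrightarrow> p \<in> fst c \<Longrightarrow> chart_inv c (snd c p) = p"
  unfolding chart_inv_def using inj_on_chart by (simp add: inv_into_f_f)

lemma transition_chart: "c \<in> A \<Longrightarrow> p \<in> fst c \<Longrightarrow> transition c d (snd c p) = snd d p"
  unfolding transition_def by (simp add: chart_inv_chart)

lemma open_chart_range: "c \<in> A \<Longrightarrow> open (chart_range c)"
  using open_overlap[of c c] by (simp add: chart_range_def)

lemma chart_in_chart_range: "p \<in> fst c \<Longrightarrow> snd c p \<in> chart_range c"
  by (simp add: chart_range_def)

lemma points_chart: "p \<in> points A \<Longrightarrow> \<exists>c\<in>A. p \<in> fst c"
  by (auto simp: points_def)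

lemma fst_chart_points: "c \<in> A \<Longrightarrow> p \<in> fst c \<Longrightarrow> p \<in> points A"
  by (auto simp: points_def)

lemma chart_at_chart: "p \<in> points A \<Longrightarrow> chart_at A p \<in> A \<and> p \<in> fst (chart_at A p)"
  unfolding chart_at_def by (rule someI_ex) (use points_chart in blast)

lemma jac_has_derivative:
  "c \<in> A \<Longrightarrow> d \<in> A \<Longrightarrow> p \<in> fst c \<Longrightarrow> p \<in> fst d \<Longrightarrow>
    (transition c d has_derivative jac c d p) (at (snd c p))"
  using transition_differentiable frechet_derivative_works by blast

lemma jac_linear:
  "c \<in> A \<Longrightarrow> d \<in> A \<Longrightarrow> p \<in> fst c \<Longrightarrow> p \<in> fst d \<Longrightarrow> linear (jac c d p)"
  using transition_differentiable linear_frechet_derivative by blast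

lemma jac_self: "c \<in> A \<Longrightarrow> p \<in> fst c \<Longrightarrow> jac c c p e = e"
proof -
  assume c: "c \<in> A" "p \<in> fst c"
  have "jac c c p = (\<lambda>x. x)"
    by (rule frechet_derivative_transform_fixed[OF has_derivative_ident open_chart_range[OF c(1)]])
      (use c in \<open>auto simp: chart_range_def transition_chart\<close>)
  then show ?thesis by simp
qed

lemma jac_comp:
  assumes "c \<in> A" "d \<in> A" "f \<in> A" "p \<in> fst c" "p \<in> fst d" "p \<in> fst f"
  shows "jac d f p (jac c d p e) = jac c f p e"
proof -
  have "((transition d f \<circ> transition c d) has_derivative (jac d f p \<circ> jac c d p)) (at (snd c p))"
    using assms by (intro diff_chain_at jac_has_derivative) (simp_all add: transition_chart jac_has_derivative)
  \<comment> \<open>The triple overlap is written as an intersection of two images known to be open;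
    injectivity of the chart \<open>c\<close> shows below that its points come from all three
    domains.\<close>
  moreover have "open (snd c ` (fst c \<inter> fst d) \<inter> snd c ` (fst c \<inter> fst f))"
    using assms open_overlap by (intro open_Int) blast+
  moreover have "snd c p \<in> snd c ` (fst c \<inter> fst d) \<inter> snd c ` (fst c \<inter> fst f)"
    using assms by auto
  moreover have "(transition d f \<circ> transition c d) y = transition c f y"
    if "y \<in> snd c ` (fst c \<inter> fst d) \<inter> snd c ` (fst c \<inter> fst f)" for y
  proof -
    from that obtain q where q: "y = snd c q" "q \<in> fst c" "q \<in> fst d" and "y \<in> snd c ` (fst c \<inter> fst f)"
      by blast
    then have "q \<in> fst f"
      using inj_onD[OF inj_on_chart[OF assms(1)]] by auto
    with q show ?thesis using assms by (simp add: transition_chart)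
  qed
  ultimately have "jac c f p = jac d f p \<circ> jac c d p"
    by (rule frechet_derivative_transform_fixed)
  then show ?thesis by simp
qed

lemma tangent_space_outside:
  "v \<in> tangent_space A p \<Longrightarrow> \<not> (c \<in> A \<and> p \<in> fst c) \<Longrightarrow> v c = 0"
  unfolding tangent_space_def by blast

lemma tangent_space_jac:
  "v \<in> tangent_space A p \<Longrightarrow> c \<in> A \<Longrightarrow> d \<in> A \<Longrightarrow> p \<in> fst c \<Longrightarrow> p \<in> fst d \<Longrightarrow> v d = jac c d p (v c)"
  unfolding tangent_space_def by blast

lemma tangent_spaceI:
  assumes "\<And>c. \<not> (c \<in> A \<and> p \<in> fst c) \<Longrightarrow> v c = 0"
    and "\<And>c d. c \<in> A \<Longrightarrow> d \<in> A \<Longrightarrow> p \<in> fst c \<Longrightarrow> p \<in> fst d \<Longrightarrow> v d = jac c d p (v c)"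
  shows "v \<in> tangent_space A p"
  unfolding tangent_space_def using assms by blast

text \<open>The transformation law yields the other components around \<open>p\<close>, and the rest
  are zero; hence one chart decides.\<close>

lemma tangent_eqI:
  assumes "u \<in> tangent_space A p" "v \<in> tangent_space A p" "c \<in> A" "p \<in> fst c" "u c = v c"
  shows "u = v"
proof
  fix d show "u d = v d"
  proof (cases "d \<in> A \<and> p \<in> fst d")
    case True
    then show ?thesis
      using tangent_space_jac[OF assms(1,3) _ assms(4), of d] tangent_space_jac[OF assms(2,3) _ assms(4), of d]
        assms(5) by simp
  next
    case False
    then show ?thesis using tangent_space_outside assms(1,2) by metis
  qed
qed

lemma coord_vector_apply:
  "d \<in> A \<Longrightarrow> p \<in> fst d \<Longrightarrow> coord_vector A c p e d = jac c d p e"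
  by (simp add: coord_vector_def)

lemma coord_vector_same: "c \<in> A \<Longrightarrow> p \<in> fst c \<Longrightarrow> coord_vector A c p e c = e"
  by (simp add: coord_vector_apply jac_self)

lemma coord_vector_in_tangent_space:
  "c \<in> A \<Longrightarrow> p \<in> fst c \<Longrightarrow> coord_vector A c p e \<in> tangent_space A p"
  by (rule tangent_spaceI) (auto simp: coord_vector_def jac_comp)

lemma coord_vector_of_tangent:
  "u \<in> tangent_space A p \<Longrightarrow> c \<in> A \<Longrightarrow> p \<in> fst c \<Longrightarrow> coord_vector A c p (u c) = u"
  by (rule tangent_eqI) (auto simp: coord_vector_in_tangent_space coord_vector_same)

lemma tangent_space_combination:
  assumes "u \<in> tangent_space A p" "v \<in> tangent_space A p"
  shows "(\<lambda>c. r *\<^sub>R u c + s *\<^sub>R v c) \<in> tangent_space A p"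
proof (rule tangent_spaceI)
  fix c d assume cd: "c \<in> A" "d \<in> A" "p \<in> fst c" "p \<in> fst d"
  show "r *\<^sub>R u d + s *\<^sub>R v d = jac c d p (r *\<^sub>R u c + s *\<^sub>R v c)"
    using tangent_space_jac[OF assms(1) cd] tangent_space_jac[OF assms(2) cd] jac_linear[OF cd]
    by (simp add: linear_add linear_scale)
qed (simp add: tangent_space_outside[OF assms(1)] tangent_space_outside[OF assms(2)])

lemma tangent_space_zero: "(\<lambda>c. 0) \<in> tangent_space A p"
  by (rule tangent_spaceI) (simp_all add: linear_0 jac_linear)

lemma tangent_space_add:
  "u \<in> tangent_space A p \<Longrightarrow> v \<in> tangent_space A p \<Longrightarrow> (\<lambda>c. u c + v c) \<in> tangent_space A p"
  using tangent_space_combination[of u p v 1 1] by simp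

lemma coord_vector_combination:
  assumes "c \<in> A" "p \<in> fst c"
  shows "coord_vector A c p (r *\<^sub>R a + s *\<^sub>R b)
    = (\<lambda>d. r *\<^sub>R coord_vector A c p a d + s *\<^sub>R coord_vector A c p b d)"
  using assms by (intro ext) (auto simp: coord_vector_def jac_linear linear_add linear_scale)

end

locale smooth_atlas =
  fixes A :: "('a, 'e::euclidean_space) chart set"
  assumes inj_on_smooth_chart: "c \<in> A \<Longrightarrow> inj_on (snd c) (fst c)"
    and open_smooth_overlap: "c \<in> A \<Longrightarrow> d \<in> A \<Longrightarrow> open (snd c ` (fst c \<inter> fst d))"
    and smooth_transition: "c \<in> A \<Longrightarrow> d \<in> A \<Longrightarrow> smooth_on (snd c ` (fst c \<inter> fst d)) (transition c d)"

sublocale smooth_atlas \<subseteq> differentiable_atlas A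
  by unfold_locales
    (auto intro: inj_on_smooth_chart open_smooth_overlap smooth_on_differentiable[OF smooth_transition])

text \<open>An overlap is open in the chart domain, so the homeomorphism sends it to a set open in
  the chart range, which is itself open in the coordinate space.\<close>

lemma smooth_manifold_imp_smooth_atlas:
  assumes "smooth_manifold X A"
  shows "smooth_atlas A"
proof
  have X: "openin X (fst c)" "open (chart_range c)"
    "homeomorphic_map (subtopology X (fst c)) (top_of_set (chart_range c)) (snd c)"
    if "c \<in> A" for c using assms that unfolding smooth_manifold_def by blast+
  show "inj_on (snd c) (fst c)" if "c \<in> A" for c
    using homeomorphic_imp_injective_map[OF X(3)[OF that]] openin_subset[OF X(1)[OF that]]
    by (simp add: Int_absorb1)
  show "open (snd c ` (fst c \<inter> fst d))" if cd: "c \<in> A" "d \<in> A" for c d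
  proof -
    have "openin (subtopology X (fst c)) (fst c \<inter> fst d)"
      using X(1)[OF cd(2)] by (simp add: openin_subtopology_Int2)
    then have "openin (top_of_set (chart_range c)) (snd c ` (fst c \<inter> fst d))"
      using homeomorphic_imp_open_map[OF X(3)[OF cd(1)]] by (simp add: open_map_def)
    then show ?thesis using X(2)[OF cd(1)] openin_open_trans by blast
  qed
  show "smooth_on (snd c ` (fst c \<inter> fst d)) (transition c d)" if "c \<in> A" "d \<in> A" for c d
    using assms that unfolding smooth_manifold_def by blast
qed

section \<open>The tangent bundle\<close>

context smooth_atlas
begin

section \<open>Induced charts of \<open>TM\<close> and their changes\<close>

lemma fst_tangent_chart: "z \<in> fst (tangent_chart A c) \<longleftrightarrow> z \<in> tangent_bundle A \<and> fst z \<in> fst c"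
  by (simp add: tangent_chart_def)

lemma snd_tangent_chart: "snd (tangent_chart A c) z = (snd c (fst z), snd z c)"
  by (simp add: tangent_chart_def)

lemma mem_tangent_bundle: "z \<in> tangent_bundle A \<longleftrightarrow> fst z \<in> points A \<and> snd z \<in> tangent_space A (fst z)"
  by (cases z) (simp add: tangent_bundle_def)

lemma points_tangent_atlas: "points (tangent_atlas A) = tangent_bundle A"
  by (auto simp: points_def tangent_atlas_def fst_tangent_chart mem_tangent_bundle)

lemma tangent_chart_in_tangent_atlas: "c \<in> A \<Longrightarrow> tangent_chart A c \<in> tangent_atlas A"
  by (simp add: tangent_atlas_def)

text \<open>Needed to define a field on \<open>TM\<close> chart by chart: its component at an
  induced chart is given in terms of the chart of \<open>M\<close> behind it.\<close>

lemma inj_on_tangent_chart: "inj_on (tangent_chart A) A"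
proof (rule inj_onI)
  have sub: "fst c \<subseteq> fst d" if "c \<in> A" "tangent_chart A c = tangent_chart A d" for c d
  proof
    fix p assume "p \<in> fst c"
    \<comment> \<open>The zero vector is a point of \<open>TM\<close> over every \<open>p\<close>,
      so the domain upstairs determines the one below.\<close>
    then have "(p, \<lambda>c. 0) \<in> fst (tangent_chart A c)"
      using that(1) by (simp add: fst_tangent_chart mem_tangent_bundle tangent_space_zero fst_chart_points)
    then show "p \<in> fst d" unfolding that(2) by (simp add: fst_tangent_chart)
  qed
  fix c d assume cd: "c \<in> A" "d \<in> A" "tangent_chart A c = tangent_chart A d"
  \<comment> \<open>Equality of charts includes the values of the coordinate maps outside the
    domains. These are visible upstairs too, because the induced map is defined by its formula at
    every pair.\<close>
  have "snd c p = snd d p" for p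
    using snd_tangent_chart[of c "(p, undefined)"] snd_tangent_chart[of d "(p, undefined)"] cd(3) by simp
  then show "c = d"
    using sub[OF cd(1,3)] sub[OF cd(2) cd(3)[symmetric]] by (intro prod_eqI) auto
qed

lemma inj_on_snd_tangent_chart:
  assumes "c \<in> A" shows "inj_on (snd (tangent_chart A c)) (fst (tangent_chart A c))"
proof (rule inj_onI)
  fix z w assume z: "z \<in> fst (tangent_chart A c)" and w: "w \<in> fst (tangent_chart A c)"
    and eq: "snd (tangent_chart A c) z = snd (tangent_chart A c) w"
  then have 1: "fst z = fst w"
    using inj_onD[OF inj_on_chart[OF assms]] by (simp add: fst_tangent_chart snd_tangent_chart)
  moreover have "snd z = snd w"
    by (rule tangent_eqI[of _ "fst z" _ c])
      (use assms z w eq 1 in \<open>auto simp: fst_tangent_chart snd_tangent_chart mem_tangent_bundle\<close>)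
  ultimately show "z = w" by (rule prod_eqI)
qed

lemma coord_vector_in_tangent_chart:
  "c \<in> A \<Longrightarrow> p \<in> fst c \<Longrightarrow> (p, coord_vector A c p y) \<in> fst (tangent_chart A c)"
  by (simp add: fst_tangent_chart mem_tangent_bundle coord_vector_in_tangent_space fst_chart_points)

lemma tangent_chart_overlap:
  assumes "c \<in> A"
  shows "snd (tangent_chart A c) ` (fst (tangent_chart A c) \<inter> fst (tangent_chart A d))
    = snd c ` (fst c \<inter> fst d) \<times> UNIV"
proof
  show "snd c ` (fst c \<inter> fst d) \<times> UNIV
    \<subseteq> snd (tangent_chart A c) ` (fst (tangent_chart A c) \<inter> fst (tangent_chart A d))"
  proof clarify
    fix p y assume p: "p \<in> fst c" "p \<in> fst d"
    then show "(snd c p, y) \<in> snd (tangent_chart A c) ` (fst (tangent_chart A c) \<inter> fst (tangent_chart A d))"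
      using coord_vector_in_tangent_chart[OF assms p(1), of y] assms
      by (intro image_eqI[of _ _ "(p, coord_vector A c p y)"])
        (auto simp: snd_tangent_chart coord_vector_same fst_tangent_chart)
  qed
qed (auto simp: fst_tangent_chart snd_tangent_chart)

lemma chart_range_tangent_chart: "c \<in> A \<Longrightarrow> chart_range (tangent_chart A c) = chart_range c \<times> UNIV"
  using tangent_chart_overlap[of c c] by (simp add: chart_range_def)

lemma chart_inv_tangent_chart:
  assumes "c \<in> A" "p \<in> fst c"
  shows "chart_inv (tangent_chart A c) (snd c p, y) = (p, coord_vector A c p y)"
  unfolding chart_inv_def
  by (intro inv_into_f_eq[OF inj_on_snd_tangent_chart] coord_vector_in_tangent_chart assms)
    (simp add: snd_tangent_chart coord_vector_same assms)

lemma transition_tangent_chart: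
  assumes "c \<in> A" "d \<in> A" "x \<in> snd c ` (fst c \<inter> fst d)"
  shows "transition (tangent_chart A c) (tangent_chart A d) (x, y)
    = (transition c d x, frechet_derivative (transition c d) (at x) y)"
  using assms
  by (auto simp: transition_def[of "tangent_chart A c"] chart_inv_tangent_chart snd_tangent_chart
      transition_chart coord_vector_apply)

text \<open>The second derivative of the transition map. It is the inhomogeneous term in the change
  of charts on \<open>TM\<close>, the one responsible for the transformation law of Christoffel
  symbols.\<close>

definition hess :: "('a, 'e) chart \<Rightarrow> ('a, 'e) chart \<Rightarrow> 'a \<Rightarrow> 'e \<Rightarrow> 'e \<Rightarrow> 'e" where
  "hess c d p a b = frechet_derivative (\<lambda>x. frechet_derivative (transition c d) (at x) b) (at (snd c p)) a"

lemma hess_has_derivative: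
  assumes "c \<in> A" "d \<in> A" "p \<in> fst c" "p \<in> fst d"
  shows "((\<lambda>x. frechet_derivative (transition c d) (at x) b) has_derivative (\<lambda>a. hess c d p a b)) (at (snd c p))"
  unfolding hess_def using assms
  by (intro smooth_on_has_derivative[OF smooth_on_frechet_derivative[OF smooth_transition]]) auto

lemma hess_symmetric:
  assumes "c \<in> A" "d \<in> A" "p \<in> fst c" "p \<in> fst d"
  shows "hess c d p a b = hess c d p b a"
  unfolding hess_def using assms
  by (intro second_derivative_symmetric[OF open_overlap[of c d] _ smooth_transition]) auto

lemma hess_zero:
  assumes "c \<in> A" "d \<in> A" "p \<in> fst c" "p \<in> fst d"
  shows "hess c d p 0 b = 0"
  using linear_0[OF has_derivative_linear[OF hess_has_derivative[OF assms]]] .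

text \<open>The fibre part of the transition is the derivative at \<open>x\<close> applied to
  \<open>y\<close>: moving the point yields the \<open>hess\<close> term, moving the vector yields
  the \<open>jac\<close> term.\<close>

lemma transition_tangent_chart_has_derivative:
  assumes cd: "c \<in> A" "d \<in> A" "p \<in> fst c" "p \<in> fst d"
  shows "(transition (tangent_chart A c) (tangent_chart A d) has_derivative
     (\<lambda>k. (jac c d p (fst k), hess c d p (fst k) y + jac c d p (snd k)))) (at (snd c p, y))"
proof (rule has_derivative_transform_within_open)
  let ?S = "snd c ` (fst c \<inter> fst d)"
  have p: "snd c p \<in> ?S" using cd by blast
  have S: "open ?S" using open_overlap cd by blast
  have lin: "linear (frechet_derivative (transition c d) (at x))" if "x \<in> ?S" for x
    using jac_linear[OF cd(1,2)] that by blast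
  have "((\<lambda>X. frechet_derivative (transition c d) (at (fst X)) (snd X)) has_derivative
      (\<lambda>k. hess c d p (fst k) y + jac c d p (snd k))) (at (snd c p, y))"
    using differentiable_apply_linear_at[where \<sigma> = fst and s = "(snd c p, y)" and u = snd
          and L = "\<lambda>x. frechet_derivative (transition c d) (at x)", OF S _ lin]
      p hess_has_derivative[OF cd] has_derivative_fst[OF has_derivative_ident]
      has_derivative_snd[OF has_derivative_ident]
    unfolding differentiable_def hess_def by simp blast
  moreover have "((\<lambda>X. transition c d (fst X)) has_derivative (\<lambda>k. jac c d p (fst k))) (at (snd c p, y))"
    by (rule has_derivative_compose_fst[OF jac_has_derivative[OF cd]])
  ultimately show "((\<lambda>X. (transition c d (fst X), frechet_derivative (transition c d) (at (fst X)) (snd X)))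
     has_derivative (\<lambda>k. (jac c d p (fst k), hess c d p (fst k) y + jac c d p (snd k)))) (at (snd c p, y))"
    by (intro has_derivative_Pair)
  show "open (?S \<times> (UNIV :: 'e set))" using S by (simp add: open_Times)
  show "(snd c p, y) \<in> ?S \<times> UNIV" using p by simp
qed (auto simp: transition_tangent_chart cd)

end

sublocale smooth_atlas \<subseteq> T: differentiable_atlas "tangent_atlas A"
proof
  fix C D assume "C \<in> tangent_atlas A" "D \<in> tangent_atlas A"
  then obtain c d where c: "c \<in> A" "C = tangent_chart A c" and d: "d \<in> A" "D = tangent_chart A d"
    by (auto simp: tangent_atlas_def)
  show "inj_on (snd C) (fst C)" using c inj_on_snd_tangent_chart by simp
  show "open (snd C ` (fst C \<inter> fst D))"
    using c d by (simp add: tangent_chart_overlap open_overlap open_Times)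
  show "transition C D differentiable (at (snd C z))" if "z \<in> fst C" "z \<in> fst D" for z
    using transition_tangent_chart_has_derivative[of c d "fst z" "snd z c"] that c d
    by (auto simp: differentiable_def snd_tangent_chart fst_tangent_chart)
qed

context smooth_atlas
begin

lemma T_jac:
  assumes "c \<in> A" "d \<in> A" "fst z \<in> fst c" "fst z \<in> fst d"
  shows "T.jac (tangent_chart A c) (tangent_chart A d) z \<xi>
    = (jac c d (fst z) (fst \<xi>), hess c d (fst z) (fst \<xi>) (snd z c) + jac c d (fst z) (snd \<xi>))"
  using frechet_derivative_eqI[OF transition_tangent_chart_has_derivative[OF assms, of "snd z c"]]
  by (simp add: snd_tangent_chart)

lemma tangent_space_tangent_atlasI:
  assumes "z \<in> tangent_bundle A"
    and "\<And>C. \<not> (C \<in> tangent_atlas A \<and> z \<in> fst C) \<Longrightarrow> \<xi> C = 0"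
    and "\<And>c d. c \<in> A \<Longrightarrow> d \<in> A \<Longrightarrow> fst z \<in> fst c \<Longrightarrow> fst z \<in> fst d \<Longrightarrow>
      \<xi> (tangent_chart A d) = (jac c d (fst z) (fst (\<xi> (tangent_chart A c))),
        hess c d (fst z) (fst (\<xi> (tangent_chart A c))) (snd z c)
        + jac c d (fst z) (snd (\<xi> (tangent_chart A c))))"
  shows "\<xi> \<in> tangent_space (tangent_atlas A) z"
proof (rule T.tangent_spaceI[OF assms(2)])
  fix C D assume *: "C \<in> tangent_atlas A" "D \<in> tangent_atlas A" "z \<in> fst C" "z \<in> fst D"
  then obtain c d where c: "c \<in> A" "C = tangent_chart A c" and d: "d \<in> A" "D = tangent_chart A d"
    by (auto simp: tangent_atlas_def)
  then have "fst z \<in> fst c" "fst z \<in> fst d" using * by (simp_all add: fst_tangent_chart)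
  then show "\<xi> D = T.jac C D z (\<xi> C)"
    unfolding c(2) d(2) T_jac[OF c(1) d(1) \<open>fst z \<in> fst c\<close> \<open>fst z \<in> fst d\<close>]
    by (intro assms(3) c d)
qed

text \<open>Differentials on \<open>TM\<close> are evaluated in a chart picked by choice; this
  identifies it as an induced one, so that the coordinate formulas apply.\<close>

lemma tangent_chart_at:
  assumes "z \<in> tangent_bundle A"
  obtains c where "c \<in> A" "fst z \<in> fst c" "chart_at (tangent_atlas A) z = tangent_chart A c"
proof -
  have "chart_at (tangent_atlas A) z \<in> tangent_chart A ` A" "z \<in> fst (chart_at (tangent_atlas A) z)"
    using T.chart_at_chart[of z] assms unfolding points_tangent_atlas by (simp_all add: tangent_atlas_def)
  then show ?thesis using that unfolding image_iff by (metis fst_tangent_chart)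
qed

section \<open>The projection and vertical vectors\<close>

text \<open>In the chosen chart the result is the Jacobian applied to the base part of the vector;
  by the transformation law of the vector this is its base part in the chart \<open>d\<close>, so
  the choice drops out.\<close>

lemma tangent_map_fst:
  assumes z: "z \<in> tangent_bundle A" and \<xi>: "\<xi> \<in> tangent_space (tangent_atlas A) z"
  shows "tangent_map (tangent_atlas A) A fst z \<xi>
    = (\<lambda>d. if d \<in> A \<and> fst z \<in> fst d then fst (\<xi> (tangent_chart A d)) else 0)"
proof
  fix d
  obtain c where c: "c \<in> A" "fst z \<in> fst c" "chart_at (tangent_atlas A) z = tangent_chart A c"
    using tangent_chart_at[OF z] .
  show "tangent_map (tangent_atlas A) A fst z \<xi> d
    = (if d \<in> A \<and> fst z \<in> fst d then fst (\<xi> (tangent_chart A d)) else 0)"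
  proof (cases "d \<in> A \<and> fst z \<in> fst d")
    case True
    then have cd: "c \<in> A" "d \<in> A" "fst z \<in> fst c" "fst z \<in> fst d" using c by auto
    have "((\<lambda>X. transition c d (fst X)) has_derivative (\<lambda>k. jac c d (fst z) (fst k)))
        (at (snd c (fst z), snd z c))"
      by (rule has_derivative_compose_fst[OF jac_has_derivative[OF cd]])
    then have "frechet_derivative (snd d \<circ> fst \<circ> chart_inv (tangent_chart A c))
        (at (snd c (fst z), snd z c)) = (\<lambda>k. jac c d (fst z) (fst k))"
      by (rule frechet_derivative_transform_fixed[where S = "snd c ` (fst c \<inter> fst d) \<times> UNIV"])
        (use cd open_overlap in \<open>auto simp: open_Times chart_inv_tangent_chart transition_chart\<close>)
    moreover have "\<xi> (tangent_chart A d) = T.jac (tangent_chart A c) (tangent_chart A d) z (\<xi> (tangent_chart A c))"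
      using T.tangent_space_jac[OF \<xi>] cd z by (simp add: tangent_chart_in_tangent_atlas fst_tangent_chart)
    ultimately show ?thesis
      using cd c(3) T_jac[OF cd] by (simp add: tangent_map_def Let_def snd_tangent_chart)
  qed (auto simp: tangent_map_def Let_def)
qed

lemma vertical_lift_tangent_chart:
  assumes "c \<in> A" "z \<in> tangent_bundle A" "fst z \<in> fst c"
  shows "vertical_lift A z u (tangent_chart A c) = (0, u c)"
proof -
  have "((\<lambda>t. (snd c (fst z), snd z c + t *\<^sub>R u c)) has_vector_derivative (0, 0 + 1 *\<^sub>R u c)) (at 0)"
    by (intro has_vector_derivative_Pair) (auto intro!: derivative_eq_intros)
  then show ?thesis
    using assms unfolding vertical_lift_def velocity_def
    by (simp add: tangent_chart_in_tangent_atlas fst_tangent_chart snd_tangent_chart vector_derivative_at)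
qed

lemma vertical_lift_outside:
  "\<not> (C \<in> tangent_atlas A \<and> z \<in> fst C) \<Longrightarrow> vertical_lift A z u C = 0"
  by (auto simp: vertical_lift_def velocity_def)

lemma vertical_lift_in_tangent_space:
  assumes "z \<in> tangent_bundle A" "u \<in> tangent_space A (fst z)"
  shows "vertical_lift A z u \<in> tangent_space (tangent_atlas A) z"
proof (rule tangent_space_tangent_atlasI[OF assms(1)])
  fix c d assume cd: "c \<in> A" "d \<in> A" "fst z \<in> fst c" "fst z \<in> fst d"
  show "vertical_lift A z u (tangent_chart A d)
    = (jac c d (fst z) (fst (vertical_lift A z u (tangent_chart A c))),
        hess c d (fst z) (fst (vertical_lift A z u (tangent_chart A c))) (snd z c)
        + jac c d (fst z) (snd (vertical_lift A z u (tangent_chart A c))))"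
    using cd assms(1) tangent_space_jac[OF assms(2) cd]
    by (simp add: vertical_lift_tangent_chart hess_zero linear_0 jac_linear)
qed (rule vertical_lift_outside)

lemma tangent_map_fst_vertical_lift:
  assumes "z \<in> tangent_bundle A" "u \<in> tangent_space A (fst z)"
  shows "tangent_map (tangent_atlas A) A fst z (vertical_lift A z u) = (\<lambda>c. 0)"
  using assms by (auto simp: tangent_map_fst vertical_lift_in_tangent_space vertical_lift_tangent_chart)

lemma vertical_lift_eqD:
  assumes "z \<in> tangent_bundle A" "u \<in> tangent_space A (fst z)" "v \<in> tangent_space A (fst z)"
    and "vertical_lift A z u = vertical_lift A z v"
  shows "u = v"
proof -
  obtain c where c: "c \<in> A" "fst z \<in> fst c" using points_chart assms(1) mem_tangent_bundle by blast
  then have "u c = v c"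
    using vertical_lift_tangent_chart[of c z] assms(1,4) by (metis prod.inject)
  then show ?thesis using tangent_eqI assms c by blast
qed

lemma vertical_is_vertical_lift:
  assumes z: "z \<in> tangent_bundle A" and \<xi>: "\<xi> \<in> tangent_space (tangent_atlas A) z"
    and 0: "tangent_map (tangent_atlas A) A fst z \<xi> = (\<lambda>c. 0)"
  shows "\<exists>u\<in>tangent_space A (fst z). vertical_lift A z u = \<xi>"
proof
  \<comment> \<open>Verticality makes the base parts vanish, so the \<open>hess\<close> term
    disappears from the transformation law and the fibre parts alone form a tangent vector of
    \<open>M\<close>.\<close>
  define u where "u c = (if c \<in> A \<and> fst z \<in> fst c then snd (\<xi> (tangent_chart A c)) else 0)" for c
  have fst0: "fst (\<xi> (tangent_chart A c)) = 0" if "c \<in> A" "fst z \<in> fst c" for c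
    using fun_cong[OF 0, of c] that by (simp add: tangent_map_fst[OF z \<xi>])
  have tr: "\<xi> (tangent_chart A d) = T.jac (tangent_chart A c) (tangent_chart A d) z (\<xi> (tangent_chart A c))"
    if "c \<in> A" "d \<in> A" "fst z \<in> fst c" "fst z \<in> fst d" for c d
    using T.tangent_space_jac[OF \<xi>] that z by (simp add: tangent_chart_in_tangent_atlas fst_tangent_chart)
  show u: "u \<in> tangent_space A (fst z)"
  proof (rule tangent_spaceI)
    fix c d assume cd: "c \<in> A" "d \<in> A" "fst z \<in> fst c" "fst z \<in> fst d"
    then show "u d = jac c d (fst z) (u c)"
      using tr[OF cd] by (simp add: u_def T_jac fst0 hess_zero)
  qed (auto simp: u_def)
  obtain c where c: "c \<in> A" "fst z \<in> fst c" using points_chart z mem_tangent_bundle by blast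
  show "vertical_lift A z u = \<xi>"
  proof (rule T.tangent_eqI[OF vertical_lift_in_tangent_space[OF z u] \<xi>])
    show "vertical_lift A z u (tangent_chart A c) = \<xi> (tangent_chart A c)"
      using c z fst0 by (simp add: vertical_lift_tangent_chart u_def prod_eq_iff)
  qed (use c z in \<open>auto simp: tangent_chart_in_tangent_atlas fst_tangent_chart\<close>)
qed

lemma geometric_representative_eqI:
  assumes "z \<in> tangent_bundle A" "u \<in> tangent_space A (fst z)" "vertical_lift A z u = W z"
  shows "geometric_representative A W z = u"
  unfolding geometric_representative_def
  using assms vertical_lift_eqD by (intro the_equality) auto

lemma vertical_field_representative:
  assumes "vertical_field A W" "z \<in> tangent_bundle A"
  shows "geometric_representative A W z \<in> tangent_space A (fst z)"
    and "vertical_lift A z (geometric_representative A W z) = W z"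
proof -
  have "W z \<in> tangent_space (tangent_atlas A) z"
    using assms by (auto simp: vertical_field_def vector_field_def points_tangent_atlas)
  then obtain u where u: "u \<in> tangent_space A (fst z)" "vertical_lift A z u = W z"
    using vertical_is_vertical_lift assms unfolding vertical_field_def by blast
  with geometric_representative_eqI[where W = W, OF assms(2) u]
  show "geometric_representative A W z \<in> tangent_space A (fst z)"
    "vertical_lift A z (geometric_representative A W z) = W z" by simp_all
qed

end

section \<open>Bilinear tensor fields in charts\<close>

context smooth_atlas
begin

definition coord_form ::
    "('a \<Rightarrow> ('a, 'e) tvec \<Rightarrow> ('a, 'e) tvec \<Rightarrow> real) \<Rightarrow> ('a, 'e) chart \<Rightarrow> 'e \<Rightarrow> 'e \<Rightarrow> 'e \<Rightarrow> real" where
  "coord_form B c x a b =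
     B (chart_inv c x) (coord_vector A c (chart_inv c x) a) (coord_vector A c (chart_inv c x) b)"

lemma coord_form_chart:
  "c \<in> A \<Longrightarrow> p \<in> fst c \<Longrightarrow> coord_form B c (snd c p) a b = B p (coord_vector A c p a) (coord_vector A c p b)"
  by (simp add: coord_form_def chart_inv_chart)

lemma coord_form_tangent:
  "c \<in> A \<Longrightarrow> p \<in> fst c \<Longrightarrow> u \<in> tangent_space A p \<Longrightarrow> v \<in> tangent_space A p \<Longrightarrow>
    coord_form B c (snd c p) (u c) (v c) = B p u v"
  by (simp add: coord_form_chart coord_vector_of_tangent)

lemma coord_form_transition:
  assumes "c \<in> A" "d \<in> A" "p \<in> fst c" "p \<in> fst d"
  shows "coord_form B c (snd c p) a b = coord_form B d (snd d p) (jac c d p a) (jac c d p b)"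
  using assms coord_form_tangent[of d p "coord_vector A c p a" "coord_vector A c p b" B]
  by (simp add: coord_form_chart[of c] coord_vector_in_tangent_space coord_vector_apply)

lemma bilinear_tensor_field_combination:
  assumes "bilinear_tensor_field A B" "p \<in> points A"
    and "u \<in> tangent_space A p" "v \<in> tangent_space A p" "w \<in> tangent_space A p"
  shows "B p (\<lambda>c. r *\<^sub>R u c + s *\<^sub>R v c) w = r * B p u w + s * B p v w"
    and "B p w (\<lambda>c. r *\<^sub>R u c + s *\<^sub>R v c) = r * B p w u + s * B p w v"
proof -
  have "\<forall>p\<in>points A. \<forall>u\<in>tangent_space A p. \<forall>v\<in>tangent_space A p. \<forall>w\<in>tangent_space A p. \<forall>r s.
        B p (\<lambda>c. r *\<^sub>R u c + s *\<^sub>R v c) w = r * B p u w + s * B p v w \<and>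
        B p w (\<lambda>c. r *\<^sub>R u c + s *\<^sub>R v c) = r * B p w u + s * B p w v"
    using assms(1) unfolding bilinear_tensor_field_def by (elim conjE)
  from this[rule_format, OF assms(2-5), of r s]
  show "B p (\<lambda>c. r *\<^sub>R u c + s *\<^sub>R v c) w = r * B p u w + s * B p v w"
    "B p w (\<lambda>c. r *\<^sub>R u c + s *\<^sub>R v c) = r * B p w u + s * B p w v" by simp_all
qed

lemma coord_form_linear:
  assumes B: "bilinear_tensor_field A B" and c: "c \<in> A" and x: "x \<in> chart_range c"
  shows "linear (coord_form B c x a)" "linear (\<lambda>a. coord_form B c x a b)"
proof -
  let ?p = "chart_inv c x"
  have p: "?p \<in> fst c" using chart_range_inverse(1)[OF x] .
  have *: "B ?p (coord_vector A c ?p (r *\<^sub>R e + s *\<^sub>R f)) (coord_vector A c ?p w)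
      = r * B ?p (coord_vector A c ?p e) (coord_vector A c ?p w)
        + s * B ?p (coord_vector A c ?p f) (coord_vector A c ?p w)"
    "B ?p (coord_vector A c ?p w) (coord_vector A c ?p (r *\<^sub>R e + s *\<^sub>R f))
      = r * B ?p (coord_vector A c ?p w) (coord_vector A c ?p e)
        + s * B ?p (coord_vector A c ?p w) (coord_vector A c ?p f)" for r s e f w
    unfolding coord_vector_combination[OF c p]
    by (rule bilinear_tensor_field_combination[OF B fst_chart_points[OF c p]
          coord_vector_in_tangent_space[OF c p] coord_vector_in_tangent_space[OF c p]
          coord_vector_in_tangent_space[OF c p]])+
  show "linear (coord_form B c x a)"
  proof (rule linearI)
    fix e f r
    show "coord_form B c x a (e + f) = coord_form B c x a e + coord_form B c x a f"
      using *(2)[of a 1 e 1 f] by (simp add: coord_form_def)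
    show "coord_form B c x a (r *\<^sub>R e) = r *\<^sub>R coord_form B c x a e"
      using *(2)[of a r e 0 0] by (simp add: coord_form_def)
  qed
  show "linear (\<lambda>a. coord_form B c x a b)"
  proof (rule linearI)
    fix e f r
    show "coord_form B c x (e + f) b = coord_form B c x e b + coord_form B c x f b"
      using *(1)[of 1 e 1 f b] by (simp add: coord_form_def)
    show "coord_form B c x (r *\<^sub>R e) b = r *\<^sub>R coord_form B c x e b"
      using *(1)[of r e 0 0 b] by (simp add: coord_form_def)
  qed
qed

lemma coord_form_smooth:
  "bilinear_tensor_field A B \<Longrightarrow> c \<in> A \<Longrightarrow> smooth_on (chart_range c) (\<lambda>x. coord_form B c x a b)"
  unfolding bilinear_tensor_field_def coord_form_def by simp

definition dform ::
    "('a \<Rightarrow> ('a, 'e) tvec \<Rightarrow> ('a, 'e) tvec \<Rightarrow> real) \<Rightarrow> ('a, 'e) chart \<Rightarrow> 'e \<Rightarrow> 'e \<Rightarrow> 'e \<Rightarrow> 'e \<Rightarrow> real" where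
  "dform B c x k a b = frechet_derivative (\<lambda>x. coord_form B c x a b) (at x) k"

lemma coord_form_differentiable:
  "bilinear_tensor_field A B \<Longrightarrow> c \<in> A \<Longrightarrow> x \<in> chart_range c \<Longrightarrow>
    (\<lambda>x. coord_form B c x a b) differentiable (at x)"
  using coord_form_smooth smooth_on_differentiable by blast

lemma dform_linear:
  assumes "bilinear_tensor_field A B" "c \<in> A" "x \<in> chart_range c"
  shows "linear (\<lambda>k. dform B c x k a b)" "linear (\<lambda>a. dform B c x k a b)" "linear (dform B c x k a)"
proof -
  show "linear (\<lambda>k. dform B c x k a b)"
    unfolding dform_def using linear_frechet_derivative[OF coord_form_differentiable[OF assms]] .
  show "linear (\<lambda>a. dform B c x k a b)"
    unfolding dform_def
    by (rule linear_frechet_derivative_parameter[OF open_chart_range[OF assms(2)] assms(3)])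
      (use assms in \<open>auto intro: coord_form_linear coord_form_differentiable\<close>)
  show "linear (dform B c x k a)"
    unfolding dform_def[abs_def]
    by (rule linear_frechet_derivative_parameter[OF open_chart_range[OF assms(2)] assms(3)])
      (use assms in \<open>auto intro: coord_form_linear coord_form_differentiable\<close>)
qed

lemma dform_smooth:
  assumes "bilinear_tensor_field A B" "c \<in> A"
  shows "smooth_on (chart_range c) (\<lambda>x. dform B c x k a b)"
  unfolding dform_def by (intro smooth_on_frechet_derivative coord_form_smooth assms)

lemma coord_form_has_derivative:
  assumes B: "bilinear_tensor_field A B" and c: "c \<in> A" and \<sigma>s: "\<sigma> s \<in> chart_range c"
    and der: "(\<sigma> has_derivative \<sigma>') (at s)" "(u has_derivative u') (at s)" "(v has_derivative v') (at s)"
  shows "((\<lambda>s. coord_form B c (\<sigma> s) (u s) (v s)) has_derivative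
     (\<lambda>k. dform B c (\<sigma> s) (\<sigma>' k) (u s) (v s)
          + coord_form B c (\<sigma> s) (u' k) (v s) + coord_form B c (\<sigma> s) (u s) (v' k))) (at s)"
  unfolding dform_def
  by (rule differentiable_apply_bilinear_at[OF open_chart_range[OF c] \<sigma>s
        coord_form_linear[OF B c] coord_form_differentiable[OF B c \<sigma>s] der])

text \<open>This is \<open>coord_form_transition\<close> differentiated along \<open>k\<close>: each
  of the two Jacobians depends on the point and contributes a \<open>hess\<close> term.\<close>

lemma dform_transition:
  assumes B: "bilinear_tensor_field A B" and cd: "c \<in> A" "d \<in> A" "p \<in> fst c" "p \<in> fst d"
  shows "dform B c (snd c p) k a b
    = dform B d (snd d p) (jac c d p k) (jac c d p a) (jac c d p b)
      + coord_form B d (snd d p) (hess c d p k a) (jac c d p b)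
      + coord_form B d (snd d p) (jac c d p a) (hess c d p k b)"
proof -
  have tp: "transition c d (snd c p) = snd d p" by (simp add: transition_chart cd)
  have "((\<lambda>x. coord_form B d (transition c d x) (frechet_derivative (transition c d) (at x) a)
        (frechet_derivative (transition c d) (at x) b)) has_derivative
     (\<lambda>k. dform B d (snd d p) (jac c d p k) (jac c d p a) (jac c d p b)
      + coord_form B d (snd d p) (hess c d p k a) (jac c d p b)
      + coord_form B d (snd d p) (jac c d p a) (hess c d p k b))) (at (snd c p))"
    using coord_form_has_derivative[OF B cd(2) _ jac_has_derivative[OF cd]
        hess_has_derivative[OF cd] hess_has_derivative[OF cd], of a b]
      chart_in_chart_range[of p d] cd(4) by (simp add: tp)
  then have "frechet_derivative (\<lambda>x. coord_form B c x a b) (at (snd c p))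
    = (\<lambda>k. dform B d (snd d p) (jac c d p k) (jac c d p a) (jac c d p b)
      + coord_form B d (snd d p) (hess c d p k a) (jac c d p b)
      + coord_form B d (snd d p) (jac c d p a) (hess c d p k b))"
    by (rule frechet_derivative_transform_fixed[OF _ open_overlap[OF cd(1,2)]])
      (use cd in \<open>auto simp: transition_chart intro: coord_form_transition[symmetric]\<close>)
  then show ?thesis by (simp add: dform_def)
qed

end

section \<open>The metric and the geodesic spray in charts\<close>

locale pseudo_riemannian_atlas = smooth_atlas A
  for A :: "('a, 'e::euclidean_space) chart set" +
  fixes g :: "'a \<Rightarrow> ('a, 'e) tvec \<Rightarrow> ('a, 'e) tvec \<Rightarrow> real"
  assumes metric: "pseudo_riemannian_metric A g"
begin

abbreviation gc :: "('a, 'e) chart \<Rightarrow> 'e \<Rightarrow> 'e \<Rightarrow> 'e \<Rightarrow> real" where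
  "gc \<equiv> coord_form g"

abbreviation dg :: "('a, 'e) chart \<Rightarrow> 'e \<Rightarrow> 'e \<Rightarrow> 'e \<Rightarrow> 'e \<Rightarrow> real" where
  "dg \<equiv> dform g"

lemma metric_bilinear: "bilinear_tensor_field A g"
  using metric by (simp add: pseudo_riemannian_metric_def)

lemma metric_symmetric:
  "p \<in> points A \<Longrightarrow> u \<in> tangent_space A p \<Longrightarrow> v \<in> tangent_space A p \<Longrightarrow> g p u v = g p v u"
  using metric unfolding pseudo_riemannian_metric_def by blast

lemma metric_nondegenerate:
  "p \<in> points A \<Longrightarrow> u \<in> tangent_space A p \<Longrightarrow> (\<And>v. v \<in> tangent_space A p \<Longrightarrow> g p u v = 0) \<Longrightarrow> u = (\<lambda>c. 0)"
  using metric unfolding pseudo_riemannian_metric_def by blast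

lemmas gc_linear = coord_form_linear[OF metric_bilinear]
lemmas dg_linear = dform_linear[OF metric_bilinear]

lemma gc_symmetric:
  assumes "c \<in> A" "x \<in> chart_range c"
  shows "gc c x a b = gc c x b a"
  unfolding coord_form_def
  by (intro metric_symmetric coord_vector_in_tangent_space fst_chart_points[OF assms(1)] assms
      chart_range_inverse)

lemma gc_nondegenerate:
  assumes c: "c \<in> A" and x: "x \<in> chart_range c" and 0: "\<And>b. gc c x a b = 0"
  shows "a = 0"
proof -
  let ?p = "chart_inv c x"
  have p: "?p \<in> fst c" "snd c ?p = x" using chart_range_inverse[OF x] .
  have "coord_vector A c ?p a = (\<lambda>c. 0)"
  proof (rule metric_nondegenerate[OF fst_chart_points[OF c p(1)] coord_vector_in_tangent_space[OF c p(1)]])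
    fix v assume "v \<in> tangent_space A ?p"
    then show "g ?p (coord_vector A c ?p a) v = 0"
      using coord_form_tangent[OF c p(1) coord_vector_in_tangent_space[OF c p(1)], of v g a] p 0
      by (simp add: coord_vector_same c)
  qed
  then show ?thesis using coord_vector_same[OF c p(1), of a] by simp
qed

text \<open>
  The metric and the linear forms on a coordinate space become endomorphisms and vectors through the
  Euclidean inner product, so that the equations of the musical isomorphism are linear systems.
\<close>

definition gram :: "('a, 'e) chart \<Rightarrow> 'e \<Rightarrow> 'e \<Rightarrow> 'e" where
  "gram c x a = (\<Sum>b\<in>Basis. gc c x a b *\<^sub>R b)"

definition riesz :: "('e \<Rightarrow> real) \<Rightarrow> 'e" where
  "riesz \<phi> = (\<Sum>b\<in>Basis. \<phi> b *\<^sub>R b)"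

lemma inner_riesz: "linear \<phi> \<Longrightarrow> riesz \<phi> \<bullet> a = \<phi> a"
  using euclidean_linear_expansion[of \<phi> a]
  by (simp add: riesz_def inner_sum_right mult.commute inner_commute)

lemma gram_inner: "c \<in> A \<Longrightarrow> x \<in> chart_range c \<Longrightarrow> gram c x a \<bullet> b = gc c x a b"
  using inner_riesz[OF gc_linear(1)] by (simp add: gram_def riesz_def)

lemma gram_linear:
  assumes "c \<in> A" "x \<in> chart_range c"
  shows "linear (gram c x)"
  using linear_add[OF gc_linear(2)[OF assms]] linear_scale[OF gc_linear(2)[OF assms]]
  by (intro linearI) (auto simp: gram_def sum.distrib scaleR_add_left scaleR_sum_right)

lemma gram_inj:
  assumes "c \<in> A" "x \<in> chart_range c"
  shows "inj (gram c x)"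
proof -
  have "a = 0" if "gram c x a = 0" for a
    using gc_nondegenerate[OF assms, of a] gram_inner[OF assms, of a] that by simp
  then show ?thesis using linear_injective_0[OF gram_linear[OF assms]] by blast
qed

lemma gram_smooth: "c \<in> A \<Longrightarrow> smooth_on (chart_range c) (\<lambda>x. gram c x a)"
  unfolding gram_def
  by (intro smooth_on_sum smooth_on_scaleR smooth_on_const open_chart_range
      coord_form_smooth[OF metric_bilinear])

lemma gram_eq_riesz_iff:
  assumes "c \<in> A" "x \<in> chart_range c" "linear \<phi>"
  shows "gram c x a = riesz \<phi> \<longleftrightarrow> (\<forall>b. gc c x a b = \<phi> b)"
  using gram_inner[OF assms(1,2)] inner_riesz[OF assms(3)] by (metis vector_eq_rdot)

text \<open>Raises the index of a linear form. Characterising it by a linear system with matrix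
  \<open>gram\<close> makes \<open>smooth_on_linear_solve\<close> applicable.\<close>

definition sharp :: "('a, 'e) chart \<Rightarrow> 'e \<Rightarrow> ('e \<Rightarrow> real) \<Rightarrow> 'e" where
  "sharp c x \<phi> = (THE a. gram c x a = riesz \<phi>)"

lemma gram_sharp:
  assumes "c \<in> A" "x \<in> chart_range c"
  shows "gram c x (sharp c x \<phi>) = riesz \<phi>"
proof -
  have "surj (gram c x)" using linear_inj_imp_surj gram_linear[OF assms] gram_inj[OF assms] by blast
  then obtain a where "gram c x a = riesz \<phi>" by (metis surjD)
  then show ?thesis
    unfolding sharp_def by (rule theI) (metis injD gram_inj[OF assms] \<open>gram c x a = riesz \<phi>\<close>)
qed

lemma sharp_eqI:
  assumes "c \<in> A" "x \<in> chart_range c" "linear \<phi>" "\<And>b. gc c x a b = \<phi> b"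
  shows "sharp c x \<phi> = a"
  using gram_sharp[OF assms(1,2), of \<phi>] gram_eq_riesz_iff[OF assms(1-3), of a] assms(4)
    injD[OF gram_inj[OF assms(1,2)]] by metis

lemma gc_sharp:
  assumes "c \<in> A" "x \<in> chart_range c" "linear \<phi>"
  shows "gc c x (sharp c x \<phi>) b = \<phi> b"
  using gram_sharp[OF assms(1,2), of \<phi>] gram_eq_riesz_iff[OF assms] by blast

text \<open>\<open>L\<close> extracts the position from the parameter: it is the projection for
  fields on \<open>TM\<close> and the identity for fields on \<open>M\<close>.\<close>

lemma sharp_smooth:
  assumes c: "c \<in> A" and S: "open S" "\<And>z. z \<in> S \<Longrightarrow> L z \<in> chart_range c" "bounded_linear L"
    and \<phi>: "\<And>b. smooth_on S (\<lambda>z. \<phi> z b)"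
  shows "smooth_on S (\<lambda>z. sharp c (L z) (\<phi> z))"
proof (rule smooth_on_linear_solve[where G = "\<lambda>z. gram c (L z)" and h = "\<lambda>z. riesz (\<phi> z)", OF S(1)])
  show "smooth_on S (\<lambda>z. gram c (L z) e)" for e
    using S by (intro smooth_on_compose_bounded_linear[OF S(3,1) _ gram_smooth[OF c]]) auto
  show "smooth_on S (\<lambda>z. riesz (\<phi> z))"
    unfolding riesz_def by (intro smooth_on_sum smooth_on_scaleR smooth_on_const S \<phi>)
qed (use S c gram_linear gram_inj gram_sharp in auto)

text \<open>
  In a chart, the fibre component \<open>f\<close> of the geodesic field at \<open>(x, y)\<close> solves
  \<open>g\<^sub>x(f, a) = D\<^sub>a g(y, y) / 2 - D\<^sub>y g(y, a)\<close> for all \<open>a\<close>.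
\<close>

definition spray_form :: "('a, 'e) chart \<Rightarrow> 'e \<Rightarrow> 'e \<Rightarrow> 'e \<Rightarrow> real" where
  "spray_form c x y a = dg c x a y y / 2 - dg c x y y a"

text \<open>With Gamma the Christoffel symbols of the Levi-Civita connection, this is -Gamma(y, y),
  the acceleration in the geodesic equation.\<close>

definition spray :: "('a, 'e) chart \<Rightarrow> 'e \<Rightarrow> 'e \<Rightarrow> 'e" where
  "spray c x y = sharp c x (spray_form c x y)"

lemma spray_form_linear:
  assumes "c \<in> A" "x \<in> chart_range c"
  shows "linear (spray_form c x y)"
  using linear_add[OF dg_linear(1)[OF assms]] linear_scale[OF dg_linear(1)[OF assms]]
    linear_add[OF dg_linear(3)[OF assms]] linear_scale[OF dg_linear(3)[OF assms]]
  by (intro linearI) (simp_all add: spray_form_def algebra_simps add_divide_distrib)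

text \<open>\<open>dg\<close> is smooth in the position for fixed arguments and linear in each slot;
  the velocity is inserted into one slot after another by
  \<open>smooth_on_apply_linear\<close>.\<close>

lemma spray_smooth:
  assumes c: "c \<in> A"
  shows "smooth_on (chart_range c \<times> UNIV) (\<lambda>z. spray c (fst z) (snd z))"
  unfolding spray_def
proof (rule sharp_smooth[OF c _ _ bounded_linear_fst])
  let ?S = "chart_range c \<times> (UNIV :: 'e set)"
  show S: "open ?S" by (intro open_Times open_chart_range c open_UNIV)
  show "fst z \<in> chart_range c" if "z \<in> ?S" for z using that by auto
  have dg0: "smooth_on ?S (\<lambda>z. dg c (fst z) k a b)" for k a b
    by (rule smooth_on_compose_bounded_linear[OF bounded_linear_fst S _ dform_smooth[OF metric_bilinear c]]) auto
  have snd: "smooth_on ?S snd" by (rule smooth_on_linear[OF bounded_linear_snd S])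
  have "smooth_on ?S (\<lambda>z. dg c (fst z) a (snd z) b)" for a b
    by (rule smooth_on_apply_linear[OF S _ dg0 snd]) (use dg_linear(2)[OF c] in auto)
  then have "smooth_on ?S (\<lambda>z. dg c (fst z) a (snd z) (snd z))" for a
    by (rule smooth_on_apply_linear[OF S _ _ snd, rotated]) (use dg_linear(3)[OF c] in auto)
  moreover have "smooth_on ?S (\<lambda>z. dg c (fst z) k (snd z) a)" for k a
    by (rule smooth_on_apply_linear[OF S _ dg0 snd]) (use dg_linear(2)[OF c] in auto)
  then have "smooth_on ?S (\<lambda>z. dg c (fst z) (snd z) (snd z) a)" for a
    by (rule smooth_on_apply_linear[OF S _ _ snd, rotated, where L = "\<lambda>z k. dg c (fst z) k (snd z) a"])
      (use dg_linear(1)[OF c] in auto)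
  ultimately show "smooth_on ?S (\<lambda>z. spray_form c (fst z) (snd z) a)" for a
    unfolding spray_form_def
    by (intro smooth_on_diff S smooth_on_bounded_linear[of "\<lambda>x. x / 2"] bounded_linear_divide)
qed

text \<open>By uniqueness of \<open>sharp\<close> it suffices to pair the right-hand side with every
  vector \<open>b\<close> and to compare with the spray form of the chart \<open>d\<close>.\<close>

lemma spray_transition:
  assumes cd: "c \<in> A" "d \<in> A" "p \<in> fst c" "p \<in> fst d"
  shows "spray d (snd d p) (jac c d p y) = hess c d p y y + jac c d p (spray c (snd c p) y)"
  unfolding spray_def[of d]
proof (rule sharp_eqI)
  have x: "snd c p \<in> chart_range c" "snd d p \<in> chart_range d"
    using cd by (auto intro: chart_in_chart_range)
  show "linear (spray_form d (snd d p) (jac c d p y))" using spray_form_linear cd x by blast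
  fix b
  \<comment> \<open>Test vectors are pulled back to the chart \<open>c\<close>, where the equation
    of its spray is available.\<close>
  define a where "a = jac d c p b"
  have b: "b = jac c d p a" using cd by (simp add: a_def jac_comp jac_self)
  let ?g = "gc d (snd d p)" and ?y = "jac c d p y" and ?f = "spray c (snd c p) y"
  have "?g (jac c d p ?f) b = spray_form c (snd c p) y a"
    using gc_sharp[OF cd(1) x(1) spray_form_linear[OF cd(1) x(1)], of y a]
      coord_form_transition[OF cd, of g ?f a] by (simp add: b spray_def)
  also have "\<dots> = spray_form d (snd d p) ?y b
      + (?g (hess c d p a y) ?y + ?g ?y (hess c d p a y)) / 2
      - ?g (hess c d p y y) b - ?g ?y (hess c d p y a)"
    by (simp add: spray_form_def dform_transition[OF metric_bilinear cd] b field_simps)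
  \<comment> \<open>Symmetry of the metric merges the two halves into one term, which cancels
    against the last one because \<open>hess\<close> is symmetric.\<close>
  also have "\<dots> = spray_form d (snd d p) ?y b - ?g (hess c d p y y) b"
    using gc_symmetric[OF cd(2) x(2), of ?y] hess_symmetric[OF cd, of a y] by simp
  finally show "?g (hess c d p y y + jac c d p ?f) b = spray_form d (snd d p) ?y b"
    using linear_add[OF gc_linear(2)[OF cd(2) x(2)]] by simp
qed (use cd in \<open>auto intro: chart_in_chart_range\<close>)

end

section \<open>The geodesic field and relativistic forces\<close>

context pseudo_riemannian_atlas
begin

section \<open>The Liouville form, the symplectic form and the energy in induced charts\<close>

lemma tangent_chart_point:
  assumes "c \<in> A" "X \<in> chart_range c \<times> UNIV"
  obtains p where "p \<in> fst c" "snd c p = fst X"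
    "chart_inv (tangent_chart A c) X = (p, coord_vector A c p (snd X))"
    "(p, coord_vector A c p (snd X)) \<in> tangent_bundle A"
proof -
  have p: "chart_inv c (fst X) \<in> fst c" "snd c (chart_inv c (fst X)) = fst X"
    using chart_range_inverse[of "fst X" c] assms by auto
  show ?thesis
    using that[OF p] chart_inv_tangent_chart[OF assms(1) p(1), of "snd X"] p(2)
      coord_vector_in_tangent_chart[OF assms(1) p(1), of "snd X"] by (simp add: fst_tangent_chart)
qed

lemma T_coord_vector_in_tangent_space:
  assumes "c \<in> A" "z \<in> tangent_bundle A" "fst z \<in> fst c"
  shows "coord_vector (tangent_atlas A) (tangent_chart A c) z e \<in> tangent_space (tangent_atlas A) z"
    and "coord_vector (tangent_atlas A) (tangent_chart A c) z e (tangent_chart A c) = e"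
  using assms T.coord_vector_in_tangent_space[of "tangent_chart A c" z]
    T.coord_vector_same[of "tangent_chart A c" z]
  by (simp_all add: tangent_chart_in_tangent_atlas fst_tangent_chart)

lemma tangent_map_fst_in_tangent_space:
  assumes z: "z \<in> tangent_bundle A" and \<xi>: "\<xi> \<in> tangent_space (tangent_atlas A) z"
  shows "tangent_map (tangent_atlas A) A fst z \<xi> \<in> tangent_space A (fst z)"
  unfolding tangent_map_fst[OF z \<xi>]
proof (rule tangent_spaceI)
  fix c d assume cd: "c \<in> A" "d \<in> A" "fst z \<in> fst c" "fst z \<in> fst d"
  have "\<xi> (tangent_chart A d) = T.jac (tangent_chart A c) (tangent_chart A d) z (\<xi> (tangent_chart A c))"
    using T.tangent_space_jac[OF \<xi>] cd z by (simp add: tangent_chart_in_tangent_atlas fst_tangent_chart)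
  then show "(if d \<in> A \<and> fst z \<in> fst d then fst (\<xi> (tangent_chart A d)) else 0)
    = jac c d (fst z) (if c \<in> A \<and> fst z \<in> fst c then fst (\<xi> (tangent_chart A c)) else 0)"
    using cd T_jac[OF cd] by simp
qed auto

text \<open>The projection keeps the base part of a vector, so the Liouville form has the classical
  expression \<open>g_ij v^i dq^j\<close>, with no component along the fibre.\<close>

lemma liouville_form_tangent_chart:
  assumes "c \<in> A" "X \<in> chart_range c \<times> UNIV"
  shows "liouville_form A g (chart_inv (tangent_chart A c) X)
      (coord_vector (tangent_atlas A) (tangent_chart A c) (chart_inv (tangent_chart A c) X) e)
    = gc c (fst X) (snd X) (fst e)"
proof -
  obtain p where p: "p \<in> fst c" "snd c p = fst X"
    "chart_inv (tangent_chart A c) X = (p, coord_vector A c p (snd X))"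
    "(p, coord_vector A c p (snd X)) \<in> tangent_bundle A"
    using tangent_chart_point[OF assms] .
  let ?z = "(p, coord_vector A c p (snd X))"
  let ?e = "coord_vector (tangent_atlas A) (tangent_chart A c) ?z e"
  have e: "?e \<in> tangent_space (tangent_atlas A) ?z" "?e (tangent_chart A c) = e"
    using T_coord_vector_in_tangent_space[OF assms(1) p(4)] p(1) by simp_all
  have "tangent_map (tangent_atlas A) A fst ?z ?e c = fst e"
    using tangent_map_fst[OF p(4) e(1)] assms(1) p(1) e(2) by simp
  then show ?thesis
    using coord_form_tangent[OF assms(1) p(1) coord_vector_in_tangent_space[OF assms(1) p(1)]
        tangent_map_fst_in_tangent_space[OF p(4) e(1), simplified], of g "snd X"]
    by (simp add: liouville_form_def p(2,3) coord_vector_same[OF assms(1) p(1)])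
qed

text \<open>Differentiating the coordinate expression of the Liouville form gives one term from the
  metric coefficients and one from the velocity. The hypothesis \<open>ch\<close> reflects that
  \<open>exterior_derivative\<close> is evaluated in the chosen chart.\<close>

lemma symplectic_form_tangent_chart:
  assumes z: "z \<in> tangent_bundle A" and c: "c \<in> A" "fst z \<in> fst c"
    and ch: "chart_at (tangent_atlas A) z = tangent_chart A c"
  shows "symplectic_form A g z \<xi> \<eta>
    = (dg c (snd c (fst z)) (fst (\<xi> (tangent_chart A c))) (snd z c) (fst (\<eta> (tangent_chart A c)))
        + gc c (snd c (fst z)) (snd (\<xi> (tangent_chart A c))) (fst (\<eta> (tangent_chart A c))))
      - (dg c (snd c (fst z)) (fst (\<eta> (tangent_chart A c))) (snd z c) (fst (\<xi> (tangent_chart A c)))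
        + gc c (snd c (fst z)) (snd (\<eta> (tangent_chart A c))) (fst (\<xi> (tangent_chart A c))))"
proof -
  let ?S = "chart_range c \<times> (UNIV :: 'e set)" and ?X = "(snd c (fst z), snd z c)"
  have S: "open ?S" "?X \<in> ?S"
    using open_chart_range c by (auto simp: open_Times chart_in_chart_range)
  have "frechet_derivative (\<lambda>X. liouville_form A g (chart_inv (tangent_chart A c) X)
      (coord_vector (tangent_atlas A) (tangent_chart A c) (chart_inv (tangent_chart A c) X) e)) (at ?X)
    = (\<lambda>k. dg c (snd c (fst z)) (fst k) (snd z c) (fst e) + gc c (snd c (fst z)) (snd k) (fst e))" for e
  proof (rule frechet_derivative_transform_fixed[OF _ S])
    have "((\<lambda>X. gc c (fst X) (snd X) (fst e)) has_derivative
      (\<lambda>k. dg c (fst ?X) (fst k) (snd ?X) (fst e) + gc c (fst ?X) (snd k) (fst e) + gc c (fst ?X) (snd ?X) 0)) (at ?X)"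
      by (rule coord_form_has_derivative[OF metric_bilinear c(1)])
        (use c in \<open>auto intro: chart_in_chart_range has_derivative_fst has_derivative_snd\<close>)
    then show "((\<lambda>X. gc c (fst X) (snd X) (fst e)) has_derivative
      (\<lambda>k. dg c (snd c (fst z)) (fst k) (snd z c) (fst e) + gc c (snd c (fst z)) (snd k) (fst e))) (at ?X)"
      using linear_0[OF gc_linear(1)[OF c(1) chart_in_chart_range[OF c(2)]]] by simp
  qed (simp add: liouville_form_tangent_chart[OF c(1)])
  then show ?thesis
    by (simp add: symplectic_form_def exterior_derivative_def ch snd_tangent_chart Let_def)
qed

lemma symplectic_form_self: "symplectic_form A g z \<xi> \<xi> = 0"
  by (simp add: symplectic_form_def exterior_derivative_def Let_def)

lemma differential_kinetic_energy_tangent_chart: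
  assumes z: "z \<in> tangent_bundle A" and c: "c \<in> A" "fst z \<in> fst c"
    and ch: "chart_at (tangent_atlas A) z = tangent_chart A c"
  shows "differential (tangent_atlas A) (kinetic_energy g) z \<xi>
    = dg c (snd c (fst z)) (fst (\<xi> (tangent_chart A c))) (snd z c) (snd z c) / 2
      + gc c (snd c (fst z)) (snd (\<xi> (tangent_chart A c))) (snd z c)"
proof -
  let ?S = "chart_range c \<times> (UNIV :: 'e set)" and ?X = "(snd c (fst z), snd z c)"
  have S: "open ?S" "?X \<in> ?S"
    using open_chart_range c by (auto simp: open_Times chart_in_chart_range)
  have "frechet_derivative (kinetic_energy g \<circ> chart_inv (tangent_chart A c)) (at ?X)
    = (\<lambda>k. (dg c (fst ?X) (fst k) (snd ?X) (snd ?X) + gc c (fst ?X) (snd k) (snd ?X)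
          + gc c (fst ?X) (snd ?X) (snd k)) / 2)"
  proof (rule frechet_derivative_transform_fixed[OF _ S])
    have "((\<lambda>X. gc c (fst X) (snd X) (snd X)) has_derivative
      (\<lambda>k. dg c (fst ?X) (fst k) (snd ?X) (snd ?X) + gc c (fst ?X) (snd k) (snd ?X)
          + gc c (fst ?X) (snd ?X) (snd k))) (at ?X)"
      by (rule coord_form_has_derivative[OF metric_bilinear c(1)])
        (use c in \<open>auto intro: chart_in_chart_range has_derivative_fst has_derivative_snd\<close>)
    then show "((\<lambda>X. gc c (fst X) (snd X) (snd X) / 2) has_derivative
      (\<lambda>k. (dg c (fst ?X) (fst k) (snd ?X) (snd ?X) + gc c (fst ?X) (snd k) (snd ?X)
          + gc c (fst ?X) (snd ?X) (snd k)) / 2)) (at ?X)"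
      by (rule bounded_linear.has_derivative[OF bounded_linear_divide])
  next
    fix X assume "X \<in> ?S"
    then obtain p where p: "p \<in> fst c" "snd c p = fst X"
      "chart_inv (tangent_chart A c) X = (p, coord_vector A c p (snd X))"
      using tangent_chart_point[OF c(1)] by blast
    show "gc c (fst X) (snd X) (snd X) / 2 = (kinetic_energy g \<circ> chart_inv (tangent_chart A c)) X"
      using coord_form_chart[OF c(1) p(1), of g] by (simp add: kinetic_energy_def p)
  qed
  then show ?thesis
    using gc_symmetric[OF c(1) chart_in_chart_range[OF c(2)], of "snd z c"]
    by (simp add: differential_def ch snd_tangent_chart Let_def field_simps)
qed

lemma differential_kinetic_energy_add:
  assumes z: "z \<in> tangent_bundle A"
  shows "differential (tangent_atlas A) (kinetic_energy g) z (\<lambda>C. \<xi> C + \<eta> C)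
    = differential (tangent_atlas A) (kinetic_energy g) z \<xi>
      + differential (tangent_atlas A) (kinetic_energy g) z \<eta>"
proof -
  obtain c where c: "c \<in> A" "fst z \<in> fst c" "chart_at (tangent_atlas A) z = tangent_chart A c"
    using tangent_chart_at[OF z] .
  note x = c(1) chart_in_chart_range[OF c(2)]
  show ?thesis
    using linear_add[OF gc_linear(2)[OF x]] linear_add[OF dg_linear(1)[OF x]]
    by (simp add: differential_kinetic_energy_tangent_chart[OF z c] add_divide_distrib)
qed

text \<open>A vertical lift has no base part, so the derivatives of the metric drop out and the
  derivative of the quadratic form along the fibre remains.\<close>

lemma differential_kinetic_energy_vertical_lift:
  assumes z: "z \<in> tangent_bundle A" and u: "u \<in> tangent_space A (fst z)"
  shows "differential (tangent_atlas A) (kinetic_energy g) z (vertical_lift A z u) = g (fst z) u (snd z)"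
proof -
  obtain c where c: "c \<in> A" "fst z \<in> fst c" "chart_at (tangent_atlas A) z = tangent_chart A c"
    using tangent_chart_at[OF z] .
  note x = c(1) chart_in_chart_range[OF c(2)]
  show ?thesis
    using linear_0[OF dg_linear(1)[OF x]] coord_form_tangent[OF c(1,2) u, of "snd z" g] z
    by (simp add: differential_kinetic_energy_tangent_chart[OF z c] vertical_lift_tangent_chart[OF c(1) z c(2)]
        mem_tangent_bundle)
qed

section \<open>Existence and uniqueness of the geodesic field\<close>

text \<open>A chart \<open>C\<close> of \<open>TM\<close> does not carry the chart of
  \<open>M\<close> that induces it, so \<open>the_inv_into\<close> recovers the latter. The default
  values are those that \<open>tangent_space\<close> and \<open>vector_field\<close>
  prescribe.\<close>

definition spray_field :: "('a, 'e) tpoint \<Rightarrow> (('a, 'e) tpoint, 'e \<times> 'e) tvec" where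
  "spray_field = (\<lambda>z\<in>tangent_bundle A. \<lambda>C.
     if C \<in> tangent_atlas A \<and> z \<in> fst C
     then let c = the_inv_into A (tangent_chart A) C in (snd z c, spray c (snd c (fst z)) (snd z c))
     else 0)"

lemma spray_field_tangent_chart:
  assumes "z \<in> tangent_bundle A" "c \<in> A" "fst z \<in> fst c"
  shows "spray_field z (tangent_chart A c) = (snd z c, spray c (snd c (fst z)) (snd z c))"
  using assms by (simp add: spray_field_def tangent_chart_in_tangent_atlas fst_tangent_chart
      the_inv_into_f_f[OF inj_on_tangent_chart])

text \<open>Since the base part is the velocity, the law on \<open>TM\<close> asks of the fibre part
  exactly the correction found in \<open>spray_transition\<close>.\<close>

lemma spray_field_in_tangent_space:
  assumes z: "z \<in> tangent_bundle A"
  shows "spray_field z \<in> tangent_space (tangent_atlas A) z"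
proof (rule tangent_space_tangent_atlasI[OF z])
  fix c d assume cd: "c \<in> A" "d \<in> A" "fst z \<in> fst c" "fst z \<in> fst d"
  have "snd z d = jac c d (fst z) (snd z c)"
    using tangent_space_jac[OF _ cd] z by (simp add: mem_tangent_bundle)
  then show "spray_field z (tangent_chart A d) =
    (jac c d (fst z) (fst (spray_field z (tangent_chart A c))),
     hess c d (fst z) (fst (spray_field z (tangent_chart A c))) (snd z c)
     + jac c d (fst z) (snd (spray_field z (tangent_chart A c))))"
    using spray_transition[OF cd, of "snd z c"] z cd by (simp add: spray_field_tangent_chart)
qed (use z in \<open>auto simp: spray_field_def\<close>)

lemma vector_field_tangent_atlasI:
  assumes "D \<in> extensional (tangent_bundle A)"
    and "\<And>z. z \<in> tangent_bundle A \<Longrightarrow> D z \<in> tangent_space (tangent_atlas A) z"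
    and "\<And>c. c \<in> A \<Longrightarrow> smooth_on (chart_range c \<times> UNIV)
      (\<lambda>X. D (chart_inv (tangent_chart A c) X) (tangent_chart A c))"
  shows "vector_field (tangent_atlas A) D"
  unfolding vector_field_def points_tangent_atlas
proof
  show "D \<in> (\<Pi>\<^sub>E z\<in>tangent_bundle A. tangent_space (tangent_atlas A) z)"
    using assms(1,2) by (simp add: PiE_def)
  show "\<forall>C\<in>tangent_atlas A. smooth_on (chart_range C) (\<lambda>X. D (chart_inv C X) C)"
  proof
    fix C assume "C \<in> tangent_atlas A"
    then obtain c where "c \<in> A" "C = tangent_chart A c" unfolding tangent_atlas_def by blast
    then show "smooth_on (chart_range C) (\<lambda>X. D (chart_inv C X) C)"
      using assms(3)[of c] chart_range_tangent_chart[of c] by simp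
  qed
qed

lemma vector_field_tangent_atlasD:
  assumes "vector_field (tangent_atlas A) D"
  shows "D \<in> extensional (tangent_bundle A)"
    and "z \<in> tangent_bundle A \<Longrightarrow> D z \<in> tangent_space (tangent_atlas A) z"
    and "c \<in> A \<Longrightarrow> smooth_on (chart_range c \<times> UNIV)
      (\<lambda>X. D (chart_inv (tangent_chart A c) X) (tangent_chart A c))"
proof -
  show "c \<in> A \<Longrightarrow> smooth_on (chart_range c \<times> UNIV)
      (\<lambda>X. D (chart_inv (tangent_chart A c) X) (tangent_chart A c))"
    using assms tangent_chart_in_tangent_atlas[of c] chart_range_tangent_chart[of c]
    unfolding vector_field_def by metis
qed (use assms in \<open>auto simp: vector_field_def points_tangent_atlas PiE_def\<close>)

lemma open_chart_range_times: "c \<in> A \<Longrightarrow> open (chart_range c \<times> (UNIV :: 'e set))"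
  by (intro open_Times open_chart_range open_UNIV)

lemma spray_field_vector_field: "vector_field (tangent_atlas A) spray_field"
proof (rule vector_field_tangent_atlasI[OF _ spray_field_in_tangent_space])
  fix c assume c: "c \<in> A"
  note S = open_chart_range_times[OF c]
  have eq: "(snd X, spray c (fst X) (snd X))
    = spray_field (chart_inv (tangent_chart A c) X) (tangent_chart A c)"
    if X: "X \<in> chart_range c \<times> UNIV" for X
  proof -
    obtain p where p: "p \<in> fst c" "snd c p = fst X"
      "chart_inv (tangent_chart A c) X = (p, coord_vector A c p (snd X))"
      "(p, coord_vector A c p (snd X)) \<in> tangent_bundle A"
      using tangent_chart_point[OF c X] .
    then show ?thesis
      using spray_field_tangent_chart[OF p(4) c] by (simp add: coord_vector_same c)
  qed
  show "smooth_on (chart_range c \<times> UNIV)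
      (\<lambda>X. spray_field (chart_inv (tangent_chart A c) X) (tangent_chart A c))"
    by (rule smooth_on_cong[OF S eq smooth_on_Pair[OF S smooth_on_linear[OF bounded_linear_snd S]
            spray_smooth[OF c]]])
qed (simp_all only: spray_field_def restrict_extensional)

lemma second_order_field_iff:
  assumes "vector_field (tangent_atlas A) D"
  shows "second_order_field A D \<longleftrightarrow> (\<forall>z\<in>tangent_bundle A. \<forall>c\<in>A. fst z \<in> fst c \<longrightarrow>
    fst (D z (tangent_chart A c)) = snd z c)"
proof -
  have "tangent_map (tangent_atlas A) A fst z (D z) = snd z \<longleftrightarrow>
    (\<forall>c\<in>A. fst z \<in> fst c \<longrightarrow> fst (D z (tangent_chart A c)) = snd z c)"
    if z: "z \<in> tangent_bundle A" for z
    unfolding tangent_map_fst[OF z vector_field_tangent_atlasD(2)[OF assms z]] fun_eq_iff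
    using tangent_space_outside[of "snd z" "fst z"] z by (auto simp: mem_tangent_bundle)
  then show ?thesis using assms by (simp add: second_order_field_def)
qed

lemma spray_field_second_order: "second_order_field A spray_field"
  unfolding second_order_field_iff[OF spray_field_vector_field]
  by (simp add: spray_field_tangent_chart)

text \<open>The pairing of the fibre part of \<open>\<xi>\<close> with the velocity enters the
  symplectic form with a minus sign and the differential of the energy with a plus sign. It cancels,
  leaving an equation on base parts.\<close>

lemma geodesic_equation_tangent_chart:
  assumes z: "z \<in> tangent_bundle A" and c: "c \<in> A" "fst z \<in> fst c"
    and ch: "chart_at (tangent_atlas A) z = tangent_chart A c"
    and D: "fst (D (tangent_chart A c)) = snd z c"
  shows "symplectic_form A g z D \<xi> + differential (tangent_atlas A) (kinetic_energy g) z \<xi>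
    = gc c (snd c (fst z)) (snd (D (tangent_chart A c))) (fst (\<xi> (tangent_chart A c)))
      - spray_form c (snd c (fst z)) (snd z c) (fst (\<xi> (tangent_chart A c)))"
  unfolding symplectic_form_tangent_chart[OF z c ch]
    differential_kinetic_energy_tangent_chart[OF z c ch] spray_form_def D
  by (simp add: field_simps)

lemma geodesic_field_eq_spray_field: "geodesic_field A g = spray_field"
  unfolding geodesic_field_def
proof (rule the_equality)
  show "second_order_field A spray_field \<and>
    (\<forall>z\<in>tangent_bundle A. \<forall>\<xi>\<in>tangent_space (tangent_atlas A) z. symplectic_form A g z (spray_field z) \<xi>
        + differential (tangent_atlas A) (kinetic_energy g) z \<xi> = 0)"
  proof (intro conjI ballI spray_field_second_order)
    fix z \<xi> assume z: "z \<in> tangent_bundle A"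
    obtain c where c: "c \<in> A" "fst z \<in> fst c" "chart_at (tangent_atlas A) z = tangent_chart A c"
      using tangent_chart_at[OF z] .
    note x = c(1) chart_in_chart_range[OF c(2)]
    show "symplectic_form A g z (spray_field z) \<xi>
        + differential (tangent_atlas A) (kinetic_energy g) z \<xi> = 0"
      using geodesic_equation_tangent_chart[OF z c, of "spray_field z" \<xi>] gc_sharp[OF x spray_form_linear[OF x]]
      by (simp add: spray_field_tangent_chart[OF z c(1,2)] spray_def)
  qed
next
  fix D assume D: "second_order_field A D \<and>
    (\<forall>z\<in>tangent_bundle A. \<forall>\<xi>\<in>tangent_space (tangent_atlas A) z. symplectic_form A g z (D z) \<xi>
        + differential (tangent_atlas A) (kinetic_energy g) z \<xi> = 0)"
  then have vf: "vector_field (tangent_atlas A) D" by (simp add: second_order_field_def)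
  show "D = spray_field"
  proof (rule extensionalityI[OF vector_field_tangent_atlasD(1)[OF vf]
        vector_field_tangent_atlasD(1)[OF spray_field_vector_field]])
    fix z assume z: "z \<in> tangent_bundle A"
    obtain c where c: "c \<in> A" "fst z \<in> fst c" "chart_at (tangent_atlas A) z = tangent_chart A c"
      using tangent_chart_at[OF z] .
    note x = c(1) chart_in_chart_range[OF c(2)]
    have D1: "fst (D z (tangent_chart A c)) = snd z c"
      using D z c second_order_field_iff[OF vf] by blast
    \<comment> \<open>The equation involves only the base part of \<open>\<xi>\<close>, so vectors
      with components \<open>(a, 0)\<close> test it completely.\<close>
    have "gc c (snd c (fst z)) (snd (D z (tangent_chart A c))) a = spray_form c (snd c (fst z)) (snd z c) a" for a
      using geodesic_equation_tangent_chart[where D = "D z"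
          and \<xi> = "coord_vector (tangent_atlas A) (tangent_chart A c) z (a, 0)", OF z c D1]
        T_coord_vector_in_tangent_space[OF c(1) z c(2), of "(a, 0)"] D z by simp
    then have "spray c (snd c (fst z)) (snd z c) = snd (D z (tangent_chart A c))"
      unfolding spray_def by (rule sharp_eqI[OF x spray_form_linear[OF x]])
    then have "D z (tangent_chart A c) = spray_field z (tangent_chart A c)"
      using D1 by (simp add: spray_field_tangent_chart[OF z c(1,2)] prod_eq_iff)
    then show "D z = spray_field z"
      using z c
      by (intro T.tangent_eqI[OF vector_field_tangent_atlasD(2)[OF vf z] spray_field_in_tangent_space[OF z]])
        (auto simp: tangent_chart_in_tangent_atlas fst_tangent_chart)
  qed
qed

section \<open>Energy conservation and relativistic forces\<close>

lemma geodesic_field_second_order: "second_order_field A (geodesic_field A g)"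
  by (simp add: geodesic_field_eq_spray_field spray_field_second_order)

lemma geodesic_field_conserves_energy:
  assumes z: "z \<in> tangent_bundle A"
  shows "differential (tangent_atlas A) (kinetic_energy g) z (geodesic_field A g z) = 0"
proof -
  obtain c where c: "c \<in> A" "fst z \<in> fst c" "chart_at (tangent_atlas A) z = tangent_chart A c"
    using tangent_chart_at[OF z] .
  note x = c(1) chart_in_chart_range[OF c(2)]
  show ?thesis
    using geodesic_equation_tangent_chart[OF z c, of "spray_field z" "spray_field z"]
      gc_sharp[OF x spray_form_linear[OF x]]
    by (simp add: geodesic_field_eq_spray_field symplectic_form_self spray_field_tangent_chart[OF z c(1,2)] spray_def)
qed

lemma relativistic_force_iff:
  assumes W: "vertical_field A W"
  shows "relativistic_force A g W \<longleftrightarrow>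
    (\<forall>z\<in>tangent_bundle A. g (fst z) (geometric_representative A W z) (snd z) = 0)"
proof -
  let ?D = "\<lambda>z\<in>tangent_bundle A. \<lambda>C. geodesic_field A g z C + W z C"
  have vf: "vector_field (tangent_atlas A) (geodesic_field A g)" "vector_field (tangent_atlas A) W"
    using geodesic_field_second_order W by (simp_all add: second_order_field_def vertical_field_def)
  \<comment> \<open>A relativistic field is in particular a second order field, so smoothness and
    tangency of the sum have to be shown before its effect on the energy.\<close>
  have D: "vector_field (tangent_atlas A) ?D"
  proof (rule vector_field_tangent_atlasI)
    show "?D z \<in> tangent_space (tangent_atlas A) z" if "z \<in> tangent_bundle A" for z
      using that T.tangent_space_add[OF vf[THEN vector_field_tangent_atlasD(2), OF that]] by simp
    fix c assume c: "c \<in> A"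
    show "smooth_on (chart_range c \<times> UNIV) (\<lambda>X. ?D (chart_inv (tangent_chart A c) X) (tangent_chart A c))"
    proof (rule smooth_on_cong[OF open_chart_range_times[OF c]])
      show "smooth_on (chart_range c \<times> UNIV)
        (\<lambda>X. geodesic_field A g (chart_inv (tangent_chart A c) X) (tangent_chart A c)
          + W (chart_inv (tangent_chart A c) X) (tangent_chart A c))"
        by (intro smooth_on_add open_chart_range_times vf[THEN vector_field_tangent_atlasD(3)] c)
      fix X assume "X \<in> chart_range c \<times> (UNIV :: 'e set)"
      from tangent_chart_point[OF c this] have "chart_inv (tangent_chart A c) X \<in> tangent_bundle A"
        by metis
      then show "geodesic_field A g (chart_inv (tangent_chart A c) X) (tangent_chart A c)
          + W (chart_inv (tangent_chart A c) X) (tangent_chart A c)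
        = ?D (chart_inv (tangent_chart A c) X) (tangent_chart A c)" by simp
    qed
  qed simp
  have W0: "fst (W z (tangent_chart A c)) = 0" if "z \<in> tangent_bundle A" "c \<in> A" "fst z \<in> fst c" for z c
    using vertical_lift_tangent_chart[OF that(2,1,3), of "geometric_representative A W z"]
      vertical_field_representative(2)[OF W that(1)] by simp
  have "second_order_field A ?D"
    unfolding second_order_field_iff[OF D]
    using geodesic_field_second_order[unfolded second_order_field_iff[OF vf(1)]] W0 by simp
  moreover have "differential (tangent_atlas A) (kinetic_energy g) z (?D z)
      = g (fst z) (geometric_representative A W z) (snd z)" if z: "z \<in> tangent_bundle A" for z
    using z differential_kinetic_energy_add[OF z, of "geodesic_field A g z" "W z"]
      geodesic_field_conserves_energy[OF z]
      differential_kinetic_energy_vertical_lift[OF z vertical_field_representative(1)[OF W z]]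
      vertical_field_representative(2)[OF W z] by simp
  ultimately show ?thesis
    using W by (simp add: relativistic_force_def relativistic_field_def)
qed

section \<open>Raising an index of a bilinear form\<close>

lemma metric_representation:
  assumes p: "p \<in> points A" and B: "bilinear_tensor_field A B" and u: "u \<in> tangent_space A p"
  shows "\<exists>!w. w \<in> tangent_space A p \<and> (\<forall>v\<in>tangent_space A p. g p w v + B p u v = 0)"
proof -
  obtain c where c: "c \<in> A" "p \<in> fst c" using points_chart[OF p] by blast
  note x = c(1) chart_in_chart_range[OF c(2)]
  have lin: "linear (\<lambda>b. - coord_form B c (snd c p) (u c) b)"
    using linear_compose_neg[OF coord_form_linear(1)[OF B x]] .
  \<comment> \<open>In a chart the condition on all \<open>v\<close> is a single equation for the
    component of \<open>w\<close>, which yields existence and uniqueness together.\<close>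
  have iff: "(\<forall>v\<in>tangent_space A p. g p w v + B p u v = 0) \<longleftrightarrow>
      w c = sharp c (snd c p) (\<lambda>b. - coord_form B c (snd c p) (u c) b)"
    if w: "w \<in> tangent_space A p" for w
  proof
    assume *: "\<forall>v\<in>tangent_space A p. g p w v + B p u v = 0"
    have "gc c (snd c p) (w c) b = - coord_form B c (snd c p) (u c) b" for b
      using bspec[OF * coord_vector_in_tangent_space[OF c, of b]]
        coord_form_tangent[OF c w coord_vector_in_tangent_space[OF c], of g b]
        coord_form_tangent[OF c u coord_vector_in_tangent_space[OF c], of B b]
      by (simp add: coord_vector_same[OF c])
    from sharp_eqI[OF x lin this]
    show "w c = sharp c (snd c p) (\<lambda>b. - coord_form B c (snd c p) (u c) b)" by simp
  next
    assume "w c = sharp c (snd c p) (\<lambda>b. - coord_form B c (snd c p) (u c) b)"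
    then show "\<forall>v\<in>tangent_space A p. g p w v + B p u v = 0"
      using gc_sharp[OF x lin] coord_form_tangent[OF c w, of _ g] coord_form_tangent[OF c u, of _ B]
      by (metis add.left_inverse)
  qed
  show ?thesis
  proof (rule ex1I)
    let ?w = "coord_vector A c p (sharp c (snd c p) (\<lambda>b. - coord_form B c (snd c p) (u c) b))"
    show *: "?w \<in> tangent_space A p \<and> (\<forall>v\<in>tangent_space A p. g p ?w v + B p u v = 0)"
      using iff coord_vector_in_tangent_space[OF c] coord_vector_same[OF c] by simp
    show "w = ?w" if "w \<in> tangent_space A p \<and> (\<forall>v\<in>tangent_space A p. g p w v + B p u v = 0)" for w
      using that * iff by (intro tangent_eqI[OF _ _ c, of w ?w]) auto
  qed
qed

text \<open>For the electromagnetic 2-form this is, up to constants, the Lorentz force. The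
  definition mentions no chart, so there is no compatibility between charts to verify.\<close>

definition lorentz :: "('a \<Rightarrow> ('a, 'e) tvec \<Rightarrow> ('a, 'e) tvec \<Rightarrow> real) \<Rightarrow> 'a \<Rightarrow> ('a, 'e) tvec \<Rightarrow> ('a, 'e) tvec" where
  "lorentz B = (\<lambda>p\<in>points A. \<lambda>u\<in>tangent_space A p.
     THE w. w \<in> tangent_space A p \<and> (\<forall>v\<in>tangent_space A p. g p w v + B p u v = 0))"

lemma lorentz:
  assumes "p \<in> points A" "bilinear_tensor_field A B" "u \<in> tangent_space A p"
  shows "lorentz B p u \<in> tangent_space A p"
    and "v \<in> tangent_space A p \<Longrightarrow> g p (lorentz B p u) v = - B p u v"
  using theI'[OF metric_representation[OF assms]] assms by (auto simp: lorentz_def eq_neg_iff_add_eq_0)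

lemma lorentz_eqI:
  assumes "p \<in> points A" "bilinear_tensor_field A B" "u \<in> tangent_space A p" "w \<in> tangent_space A p"
    and "\<And>v. v \<in> tangent_space A p \<Longrightarrow> g p w v + B p u v = 0"
  shows "lorentz B p u = w"
  using metric_representation[OF assms(1-3)] assms unfolding lorentz_def
  by (simp add: the1_equality)

lemma lorentz_coord:
  assumes c: "c \<in> A" "p \<in> fst c" and B: "bilinear_tensor_field A B"
  shows "lorentz B p (coord_vector A c p e) c = sharp c (snd c p) (\<lambda>b. - coord_form B c (snd c p) e b)"
proof (rule sharp_eqI[symmetric, OF c(1) chart_in_chart_range[OF c(2)]])
  show "linear (\<lambda>b. - coord_form B c (snd c p) e b)"
    using linear_compose_neg[OF coord_form_linear(1)[OF B c(1) chart_in_chart_range[OF c(2)]]] .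
  note L = lorentz[OF fst_chart_points[OF c] B coord_vector_in_tangent_space[OF c]]
  show "gc c (snd c p) (lorentz B p (coord_vector A c p e) c) b = - coord_form B c (snd c p) e b" for b
    using coord_form_tangent[OF c L(1) coord_vector_in_tangent_space[OF c], of g e b]
      L(2)[OF coord_vector_in_tangent_space[OF c], of e b] coord_form_chart[OF c, of B]
    by (simp add: coord_vector_same[OF c])
qed

text \<open>The combination of the two solutions solves the equation for the combined vector, and
  solutions are unique.\<close>

lemma lorentz_combination:
  assumes p: "p \<in> points A" and B: "bilinear_tensor_field A B"
    and u: "u \<in> tangent_space A p" and v: "v \<in> tangent_space A p"
  shows "lorentz B p (\<lambda>c. r *\<^sub>R u c + s *\<^sub>R v c) = (\<lambda>c. r *\<^sub>R lorentz B p u c + s *\<^sub>R lorentz B p v c)"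
proof (rule lorentz_eqI[OF p B tangent_space_combination[OF u v]])
  note L = lorentz[OF p B]
  show "(\<lambda>c. r *\<^sub>R lorentz B p u c + s *\<^sub>R lorentz B p v c) \<in> tangent_space A p"
    by (intro tangent_space_combination L u v)
  fix w assume w: "w \<in> tangent_space A p"
  show "g p (\<lambda>c. r *\<^sub>R lorentz B p u c + s *\<^sub>R lorentz B p v c) w + B p (\<lambda>c. r *\<^sub>R u c + s *\<^sub>R v c) w = 0"
    unfolding bilinear_tensor_field_combination(1)[OF metric_bilinear p L(1)[OF u] L(1)[OF v] w]
      bilinear_tensor_field_combination(1)[OF B p u v w]
    by (simp add: L(2)[OF u w] L(2)[OF v w])
qed

lemma lorentz_endomorphism_field:
  assumes B: "bilinear_tensor_field A B"
  shows "endomorphism_field A (lorentz B)"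
  unfolding endomorphism_field_def
proof (intro conjI ballI allI)
  show "lorentz B \<in> (\<Pi>\<^sub>E p\<in>points A. tangent_space A p \<rightarrow>\<^sub>E tangent_space A p)"
    by (intro PiE_I lorentz(1)[OF _ B]) (simp_all add: lorentz_def)
  fix c e assume c: "c \<in> A"
  show "smooth_on (chart_range c) (\<lambda>x. lorentz B (chart_inv c x) (coord_vector A c (chart_inv c x) e) c)"
  proof (rule smooth_on_cong[OF open_chart_range[OF c]])
    show "smooth_on (chart_range c) (\<lambda>x. sharp c x (\<lambda>b. - coord_form B c x e b))"
      by (intro sharp_smooth[where L = "\<lambda>x. x", OF c] smooth_on_minus coord_form_smooth B c
          open_chart_range bounded_linear_ident)
    show "sharp c x (\<lambda>b. - coord_form B c x e b)
      = lorentz B (chart_inv c x) (coord_vector A c (chart_inv c x) e) c" if "x \<in> chart_range c" for x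
      using lorentz_coord[OF c chart_range_inverse(1)[OF that] B] chart_range_inverse(2)[OF that] by simp
  qed
qed (rule lorentz_combination[OF _ B])

section \<open>Forces given by endomorphism fields\<close>

definition force_of_endomorphism ::
    "('a \<Rightarrow> ('a, 'e) tvec \<Rightarrow> ('a, 'e) tvec) \<Rightarrow> ('a, 'e) tpoint \<Rightarrow> (('a, 'e) tpoint, 'e \<times> 'e) tvec" where
  "force_of_endomorphism \<Phi> = (\<lambda>z\<in>tangent_bundle A. vertical_lift A z (\<Phi> (fst z) (snd z)))"

lemma endomorphism_field_in_tangent_space:
  "endomorphism_field A \<Phi> \<Longrightarrow> p \<in> points A \<Longrightarrow> u \<in> tangent_space A p \<Longrightarrow> \<Phi> p u \<in> tangent_space A p"
  unfolding endomorphism_field_def by (auto simp: PiE_def Pi_def)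

lemma endomorphism_field_combination:
  "endomorphism_field A \<Phi> \<Longrightarrow> p \<in> points A \<Longrightarrow> u \<in> tangent_space A p \<Longrightarrow> v \<in> tangent_space A p \<Longrightarrow>
    \<Phi> p (\<lambda>c. r *\<^sub>R u c + s *\<^sub>R v c) = (\<lambda>c. r *\<^sub>R \<Phi> p u c + s *\<^sub>R \<Phi> p v c)"
  unfolding endomorphism_field_def by simp

lemma endomorphism_field_smooth:
  "endomorphism_field A \<Phi> \<Longrightarrow> c \<in> A \<Longrightarrow>
    smooth_on (chart_range c) (\<lambda>x. \<Phi> (chart_inv c x) (coord_vector A c (chart_inv c x) e) c)"
  unfolding endomorphism_field_def by simp

lemma endomorphism_coord_linear:
  assumes \<Phi>: "endomorphism_field A \<Phi>" and c: "c \<in> A" "p \<in> fst c"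
  shows "linear (\<lambda>e. \<Phi> p (coord_vector A c p e) c)"
proof -
  have *: "\<Phi> p (coord_vector A c p (r *\<^sub>R a + s *\<^sub>R b)) c
    = r *\<^sub>R \<Phi> p (coord_vector A c p a) c + s *\<^sub>R \<Phi> p (coord_vector A c p b) c" for r s a b
    unfolding coord_vector_combination[OF c]
    using endomorphism_field_combination[OF \<Phi> fst_chart_points[OF c]
        coord_vector_in_tangent_space[OF c] coord_vector_in_tangent_space[OF c]] by simp
  show ?thesis
  proof (rule linearI)
    fix a b r
    show "\<Phi> p (coord_vector A c p (a + b)) c = \<Phi> p (coord_vector A c p a) c + \<Phi> p (coord_vector A c p b) c"
      using *[of 1 a 1 b] by simp
    show "\<Phi> p (coord_vector A c p (r *\<^sub>R a)) c = r *\<^sub>R \<Phi> p (coord_vector A c p a) c"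
      using *[of r a 0 0] by simp
  qed
qed

text \<open>In an induced chart the base part is zero and the fibre part is linear in the velocity
  with coefficients smooth in the position.\<close>

lemma force_of_endomorphism_vertical_field:
  assumes \<Phi>: "endomorphism_field A \<Phi>"
  shows "vertical_field A (force_of_endomorphism \<Phi>)"
  unfolding vertical_field_def
proof
  have \<Phi>z: "\<Phi> (fst z) (snd z) \<in> tangent_space A (fst z)" if "z \<in> tangent_bundle A" for z
    using endomorphism_field_in_tangent_space[OF \<Phi>] that by (simp add: mem_tangent_bundle)
  show "vector_field (tangent_atlas A) (force_of_endomorphism \<Phi>)"
  proof (rule vector_field_tangent_atlasI)
    fix c assume c: "c \<in> A"
    let ?S = "chart_range c \<times> (UNIV :: 'e set)"
    note S = open_chart_range_times[OF c]
    have p: "chart_inv c (fst X) \<in> fst c" "snd c (chart_inv c (fst X)) = fst X" if "X \<in> ?S" for X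
      using chart_range_inverse[of "fst X" c] that by auto
    show "smooth_on ?S (\<lambda>X. force_of_endomorphism \<Phi> (chart_inv (tangent_chart A c) X) (tangent_chart A c))"
    proof (rule smooth_on_cong[OF S])
      have "smooth_on ?S (\<lambda>X. \<Phi> (chart_inv c (fst X)) (coord_vector A c (chart_inv c (fst X)) (snd X)) c)"
      proof (rule smooth_on_apply_linear[OF S, where u = snd
            and L = "\<lambda>X e. \<Phi> (chart_inv c (fst X)) (coord_vector A c (chart_inv c (fst X)) e) c"])
        show "linear (\<lambda>e. \<Phi> (chart_inv c (fst X)) (coord_vector A c (chart_inv c (fst X)) e) c)"
          if "X \<in> ?S" for X
          by (rule endomorphism_coord_linear[OF \<Phi> c p(1)[OF that]])
        show "smooth_on ?S (\<lambda>X. \<Phi> (chart_inv c (fst X)) (coord_vector A c (chart_inv c (fst X)) e) c)" for e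
          by (rule smooth_on_compose_bounded_linear[OF bounded_linear_fst S _ endomorphism_field_smooth[OF \<Phi> c]]) auto
        show "smooth_on ?S snd" by (rule smooth_on_linear[OF bounded_linear_snd S])
      qed
      then show "smooth_on ?S (\<lambda>X. (0 :: 'e, \<Phi> (chart_inv c (fst X)) (coord_vector A c (chart_inv c (fst X)) (snd X)) c))"
        by (intro smooth_on_Pair smooth_on_const S)
      fix X assume X: "X \<in> ?S"
      have eq: "chart_inv (tangent_chart A c) X = (chart_inv c (fst X), coord_vector A c (chart_inv c (fst X)) (snd X))"
        using chart_inv_tangent_chart[OF c p(1)[OF X], of "snd X"] p(2)[OF X] by simp
      have "(chart_inv c (fst X), coord_vector A c (chart_inv c (fst X)) (snd X)) \<in> tangent_bundle A"
        using coord_vector_in_tangent_chart[OF c p(1)[OF X]] by (simp add: fst_tangent_chart)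
      then show "(0, \<Phi> (chart_inv c (fst X)) (coord_vector A c (chart_inv c (fst X)) (snd X)) c)
        = force_of_endomorphism \<Phi> (chart_inv (tangent_chart A c) X) (tangent_chart A c)"
        using c p(1)[OF X] by (simp add: eq force_of_endomorphism_def vertical_lift_tangent_chart)
    qed
  qed (use \<Phi>z vertical_lift_in_tangent_space in \<open>auto simp: force_of_endomorphism_def\<close>)
  show "\<forall>z\<in>tangent_bundle A. tangent_map (tangent_atlas A) A fst z (force_of_endomorphism \<Phi> z) = (\<lambda>c. 0)"
    using tangent_map_fst_vertical_lift \<Phi>z by (simp add: force_of_endomorphism_def)
qed

lemma force_of_endomorphism_representative:
  assumes "endomorphism_field A \<Phi>" "z \<in> tangent_bundle A"
  shows "geometric_representative A (force_of_endomorphism \<Phi>) z = \<Phi> (fst z) (snd z)"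
  using assms endomorphism_field_in_tangent_space
  by (intro geometric_representative_eqI) (auto simp: force_of_endomorphism_def mem_tangent_bundle)

section \<open>The correspondence between forces and 2-forms\<close>

text \<open>Tensor fields are extensional in each of their three arguments, so the values on the
  manifold and its tangent spaces fix the function.\<close>

lemma bilinear_tensor_field_eqI:
  assumes "bilinear_tensor_field A F" "bilinear_tensor_field A G"
    and "\<And>p u v. p \<in> points A \<Longrightarrow> u \<in> tangent_space A p \<Longrightarrow> v \<in> tangent_space A p \<Longrightarrow> F p u v = G p u v"
  shows "F = G"
proof -
  have F: "F \<in> (\<Pi>\<^sub>E p\<in>points A. \<Pi>\<^sub>E u\<in>tangent_space A p. \<Pi>\<^sub>E v\<in>tangent_space A p. UNIV)"
    and G: "G \<in> (\<Pi>\<^sub>E p\<in>points A. \<Pi>\<^sub>E u\<in>tangent_space A p. \<Pi>\<^sub>E v\<in>tangent_space A p. UNIV)"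
    using assms(1,2) by (simp_all add: bilinear_tensor_field_def)
  show ?thesis
  proof (rule PiE_ext[OF F G])
    fix p assume p: "p \<in> points A"
    show "F p = G p"
    proof (rule PiE_ext[OF PiE_mem[OF F p] PiE_mem[OF G p]])
      fix u assume u: "u \<in> tangent_space A p"
      show "F p u = G p u"
        by (rule PiE_ext[OF PiE_mem[OF PiE_mem[OF F p] u] PiE_mem[OF PiE_mem[OF G p] u]])
          (rule assms(3)[OF p u])
    qed
  qed
qed

lemma two_form_associated_ex1:
  assumes W: "relativistic_force A g W" "linear_in_velocities A W"
  shows "\<exists>!F. two_form A F \<and> associated A g W F"
proof (rule ex_ex1I)
  have V: "vertical_field A W" using W(1) by (simp add: relativistic_force_def)
  obtain \<Phi> where \<Phi>: "endomorphism_field A \<Phi>"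
    "\<And>z. z \<in> tangent_bundle A \<Longrightarrow> geometric_representative A W z = \<Phi> (fst z) (snd z)"
    using W(2) by (auto simp: linear_in_velocities_def)
  note \<Phi>T = endomorphism_field_in_tangent_space[OF \<Phi>(1)]
  \<comment> \<open>\<open>associated\<close> forces this value, sign included; the restrictions
    make it extensional.\<close>
  define F where "F = (\<lambda>p\<in>points A. \<lambda>u\<in>tangent_space A p. \<lambda>v\<in>tangent_space A p. - g p (\<Phi> p u) v)"
  have F: "F p u v = - g p (\<Phi> p u) v"
    if "p \<in> points A" "u \<in> tangent_space A p" "v \<in> tangent_space A p" for p u v
    using that by (simp add: F_def)
  have "bilinear_tensor_field A F"
    unfolding bilinear_tensor_field_def
  proof (intro conjI ballI allI)
    fix p u v w r s assume p: "p \<in> points A"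
      and u: "u \<in> tangent_space A p" and v: "v \<in> tangent_space A p" and w: "w \<in> tangent_space A p"
    show "F p (\<lambda>c. r *\<^sub>R u c + s *\<^sub>R v c) w = r * F p u w + s * F p v w"
      using bilinear_tensor_field_combination(1)[OF metric_bilinear p \<Phi>T[OF p u] \<Phi>T[OF p v] w]
      by (simp add: F p u v w tangent_space_combination endomorphism_field_combination[OF \<Phi>(1)])
    show "F p w (\<lambda>c. r *\<^sub>R u c + s *\<^sub>R v c) = r * F p w u + s * F p w v"
      using bilinear_tensor_field_combination(2)[OF metric_bilinear p u v \<Phi>T[OF p w]]
      by (simp add: F p u v w tangent_space_combination)
  next
    fix c e f assume c: "c \<in> A"
    show "smooth_on (chart_range c) (\<lambda>x. F (chart_inv c x) (coord_vector A c (chart_inv c x) e)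
        (coord_vector A c (chart_inv c x) f))"
    proof (rule smooth_on_cong[OF open_chart_range[OF c]])
      show "smooth_on (chart_range c)
          (\<lambda>x. - gc c x (\<Phi> (chart_inv c x) (coord_vector A c (chart_inv c x) e) c) f)"
        by (rule smooth_on_minus[OF open_chart_range[OF c]
              smooth_on_apply_linear[where L = "\<lambda>x a. gc c x a f", OF open_chart_range[OF c]
                gc_linear(2)[OF c] coord_form_smooth[OF metric_bilinear c]
                endomorphism_field_smooth[OF \<Phi>(1) c]]])
      fix x assume "x \<in> chart_range c"
      note p = chart_range_inverse[OF this]
      note T = fst_chart_points[OF c p(1)] coord_vector_in_tangent_space[OF c p(1)]
      show "- gc c x (\<Phi> (chart_inv c x) (coord_vector A c (chart_inv c x) e) c) f
        = F (chart_inv c x) (coord_vector A c (chart_inv c x) e) (coord_vector A c (chart_inv c x) f)"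
        using coord_form_tangent[OF c p(1) \<Phi>T[OF T] T(2), of g e f]
        by (simp add: F T p(2) coord_vector_same[OF c p(1)])
    qed
  qed (auto simp: F_def)
  \<comment> \<open>Alternation is the relativistic condition at the point \<open>(p, u)\<close> of
    \<open>TM\<close>, where the velocity is \<open>u\<close> itself.\<close>
  moreover have "F p u u = 0" if "p \<in> points A" "u \<in> tangent_space A p" for p u
  proof -
    have z: "(p, u) \<in> tangent_bundle A" using that by (simp add: mem_tangent_bundle)
    then show ?thesis
      using relativistic_force_iff[OF V] W(1) \<Phi>(2)[OF z] that by (auto simp: F)
  qed
  moreover have "associated A g W F"
    unfolding associated_def using \<Phi>(2) F by (simp add: mem_tangent_bundle)
  ultimately show "\<exists>F. two_form A F \<and> associated A g W F"
    unfolding two_form_def by blast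
next
  fix F G assume FG: "two_form A F \<and> associated A g W F" "two_form A G \<and> associated A g W G"
  show "F = G"
  proof (rule bilinear_tensor_field_eqI)
    fix p u v assume p: "p \<in> points A" "u \<in> tangent_space A p" "v \<in> tangent_space A p"
    then have "(p, u) \<in> tangent_bundle A" by (simp add: mem_tangent_bundle)
    then have "g p (geometric_representative A W (p, u)) v + F p u v = 0"
      "g p (geometric_representative A W (p, u)) v + G p u v = 0"
      using FG p(3) unfolding associated_def by fastforce+
    then show "F p u v = G p u v" by simp
  qed (use FG in \<open>simp_all add: two_form_def\<close>)
qed

lemma force_associated_ex1:
  assumes F: "two_form A F"
  shows "\<exists>!W. relativistic_force A g W \<and> linear_in_velocities A W \<and> associated A g W F"
proof (rule ex1I)
  have B: "bilinear_tensor_field A F" using F by (simp add: two_form_def)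
  note \<Phi> = lorentz_endomorphism_field[OF B]
  note V = force_of_endomorphism_vertical_field[OF \<Phi>]
  note rep = force_of_endomorphism_representative[OF \<Phi>]
  let ?W = "force_of_endomorphism (lorentz F)"
  have g: "g (fst z) (lorentz F (fst z) (snd z)) u = - F (fst z) (snd z) u"
    if "z \<in> tangent_bundle A" "u \<in> tangent_space A (fst z)" for z u
    using lorentz(2)[OF _ B] that by (simp add: mem_tangent_bundle)
  \<comment> \<open>The power of the force at a velocity is minus the value of \<open>F\<close> on
    that vector twice, hence zero.\<close>
  have "relativistic_force A g ?W"
    unfolding relativistic_force_iff[OF V]
    using F g rep by (simp add: two_form_def mem_tangent_bundle)
  moreover have "linear_in_velocities A ?W"
    unfolding linear_in_velocities_def using \<Phi> rep by blast
  moreover have "associated A g ?W F"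
    unfolding associated_def using rep g by simp
  ultimately show "relativistic_force A g ?W \<and> linear_in_velocities A ?W \<and> associated A g ?W F"
    by blast
  fix W assume W: "relativistic_force A g W \<and> linear_in_velocities A W \<and> associated A g W F"
  then have VW: "vertical_field A W" by (simp add: relativistic_force_def)
  show "W = ?W"
  proof (rule extensionalityI)
    show "W \<in> extensional (tangent_bundle A)" "?W \<in> extensional (tangent_bundle A)"
      using VW V vector_field_tangent_atlasD(1) by (simp_all add: vertical_field_def)
    fix z assume z: "z \<in> tangent_bundle A"
    \<comment> \<open>The representative of \<open>W\<close> solves the equation that defines
      \<open>lorentz F\<close>; being vertical, \<open>W\<close> is then recovered as the lift of
      its representative.\<close>
    have "lorentz F (fst z) (snd z) = geometric_representative A W z"
    proof (rule lorentz_eqI[OF _ B])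
      show "fst z \<in> points A" "snd z \<in> tangent_space A (fst z)" using z by (simp_all add: mem_tangent_bundle)
      show "geometric_representative A W z \<in> tangent_space A (fst z)"
        by (rule vertical_field_representative[OF VW z])
      show "g (fst z) (geometric_representative A W z) v + F (fst z) (snd z) v = 0"
        if "v \<in> tangent_space A (fst z)" for v
        using W z that by (simp add: associated_def)
    qed
    then show "W z = ?W z"
      using vertical_field_representative(2)[OF VW z] z by (simp add: force_of_endomorphism_def)
  qed
qed

end

text \<open>The relation \<open>associated\<close> is built from the metric without choices. Unique
  solvability in both directions makes it the graph of a bijection, which is the content of the word
  canonical.\<close>

theorem theorem4p5:
  fixes X :: "'a topology"
    and A :: "('a, 'e::euclidean_space) chart set"
    and g :: "'a \<Rightarrow> ('a, 'e) tvec \<Rightarrow> ('a, 'e) tvec \<Rightarrow> real"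
  assumes "smooth_manifold X A"
    and "pseudo_riemannian_metric A g"
  shows "(\<forall>W. relativistic_force A g W \<and> linear_in_velocities A W \<longrightarrow>
            (\<exists>!F. two_form A F \<and> associated A g W F)) \<and>
         (\<forall>F. two_form A F \<longrightarrow>
            (\<exists>!W. relativistic_force A g W \<and> linear_in_velocities A W \<and> associated A g W F))"
proof -
  interpret smooth_atlas A by (rule smooth_manifold_imp_smooth_atlas[OF assms(1)])
  interpret pseudo_riemannian_atlas A g by unfold_locales (rule assms(2))
  show ?thesis using two_form_associated_ex1 force_associated_ex1 by blast
qed

end
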